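(* Let $\Omega\subset\mathbb{R}$ be a bounded domain and $p\in[1,\infty)$. If $n:\Omega\to\mathbb{R}^3$ satisfies $|n|=1$ and $n\otimes n\in W^{1,p}_{loc}(\Omega,\mathbb{R}^{3\times3})$, then there exists $m\in W^{1,p}_{loc}(\Omega,\mathbb{S}^2)$ such that $m\otimes m=n\otimes n$ on $\Omega$.
   Context: Sobolev functions are always identified with their precise representatives (in one dimension, the continuous ones). *)

theory Defs
  imports "HOL-Analysis.Analysis"
begin

definition tensor :: "real^'m \<Rightarrow> real^'k \<Rightarrow> real^'k^'m"  (infixl "\<otimes>\<^sub>v" 75)
  where "u \<otimes>\<^sub>v v = (\<chi> i j. u $ i * v $ j)"

definition test_function :: "real set \<Rightarrow> (real \<Rightarrow> real) \<Rightarrow> bool"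
  where "test_function \<Omega> \<phi> \<longleftrightarrow>
    (\<forall>k x. (deriv ^^ k) \<phi> differentiable (at x)) \<and>
    compact (closure {x. \<phi> x \<noteq> 0}) \<and> closure {x. \<phi> x \<noteq> 0} \<subseteq> \<Omega>"

definition Lp_loc :: "real \<Rightarrow> real set \<Rightarrow> (real \<Rightarrow> 'b::euclidean_space) set"
  where "Lp_loc p \<Omega> = {f. f \<in> borel_measurable (lebesgue_on \<Omega>) \<and>
    (\<forall>K. compact K \<and> K \<subseteq> \<Omega> \<longrightarrow> set_integrable lebesgue K (\<lambda>x. norm (f x) powr p))}"

definition weak_derivative_on ::
    "real set \<Rightarrow> (real \<Rightarrow> 'b::euclidean_space) \<Rightarrow> (real \<Rightarrow> 'b) \<Rightarrow> bool"
  where "weak_derivative_on \<Omega> f g \<longleftrightarrow>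
    (\<forall>\<phi>. test_function \<Omega> \<phi> \<longrightarrow>
      (LINT x:\<Omega>|lebesgue. deriv \<phi> x *\<^sub>R f x) = - (LINT x:\<Omega>|lebesgue. \<phi> x *\<^sub>R g x))"

(* Membership is invariant under changes of f on a null set; the choice of a representative
   is made separately, through precise_rep below. *)
definition W1p_loc :: "real \<Rightarrow> real set \<Rightarrow> (real \<Rightarrow> 'b::euclidean_space) set"
  where "W1p_loc p \<Omega> = {f. f \<in> Lp_loc p \<Omega> \<and>
    (\<exists>g. g \<in> Lp_loc p \<Omega> \<and> weak_derivative_on \<Omega> f g)}"

(* The limit of the averages of f over shrinking balls, with the usual convention 0 where
   the limit does not exist. *)
definition precise_rep :: "(real \<Rightarrow> 'b::euclidean_space) \<Rightarrow> real \<Rightarrow> 'b"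
  where "precise_rep f x =
    (let avg = (\<lambda>r. (1 / measure lebesgue (ball x r)) *\<^sub>R (LINT y:ball x r|lebesgue. f y))
     in if \<exists>l. (avg \<longlongrightarrow> l) (at_right 0) then Lim (at_right 0) avg else 0)"

(* In one dimension the precise representative is the continuous one. In particular
   precise_rep f agrees with f on \<Omega> if f is itself continuous on \<Omega>. *)
lemma precise_rep_eq_continuous:
  fixes f g :: "real \<Rightarrow> 'b::euclidean_space"
  assumes "open \<Omega>" "x \<in> \<Omega>" and cont: "continuous_on \<Omega> g"
    and meas: "f \<in> borel_measurable (lebesgue_on \<Omega>)"
    and ae: "AE y in lebesgue. y \<in> \<Omega> \<longrightarrow> f y = g y"
  shows "precise_rep f x = g x"
proof -
  define avg where
    "avg = (\<lambda>r. (1 / measure lebesgue (ball x r)) *\<^sub>R (LINT y:ball x r|lebesgue. f y))"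
  have "(avg \<longlongrightarrow> g x) (at_right 0)"
  proof (rule tendstoI)
    fix e :: real assume e: "e > 0"
    obtain d1 where d1: "d1 > 0" "cball x d1 \<subseteq> \<Omega>"
      using assms(1,2) open_contains_cball by blast
    obtain d2 where d2: "d2 > 0" "\<And>y. y \<in> \<Omega> \<Longrightarrow> dist y x < d2 \<Longrightarrow> dist (g y) (g x) < e/2"
      using cont assms(2) e unfolding continuous_on_iff by (meson half_gt_zero)
    have "dist (avg r) (g x) < e" if r: "0 < r" "r < min d1 d2" for r
    proof -
      let ?B = "ball x r"
      have sub: "?B \<subseteq> \<Omega>" "cball x r \<subseteq> \<Omega>" using r d1 by (auto simp: subset_iff)
      have Bm: "?B \<in> sets lebesgue" "?B \<in> lmeasurable" by auto
      have mB: "measure lebesgue ?B = 2 * r" using r by (simp add: ball_eq_greaterThanLessThan)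
      have gi: "set_integrable lebesgue ?B g"
      proof (rule set_integrable_subset)
        have "continuous_on {x - r..x + r} g"
          using continuous_on_subset[OF cont sub(2)] by (simp add: cball_eq_atLeastAtMost)
        then show "set_integrable lebesgue {x - r..x + r} g"
          by (rule absolutely_integrable_continuous_real)
      qed (auto simp: dist_real_def)
      have ci: "set_integrable lebesgue ?B (\<lambda>_. g x)"
        using Bm unfolding set_integrable_def by (auto simp: fmeasurable_def)
      have \<Omega>m: "\<Omega> \<in> sets lebesgue" using assms(1) by auto
      have fm: "(\<lambda>y. indicator ?B y *\<^sub>R f y) \<in> borel_measurable lebesgue"
      proof -
        have *: "(\<lambda>y. indicator \<Omega> y *\<^sub>R f y) \<in> borel_measurable lebesgue"
          using meas \<Omega>m by (simp add: borel_measurable_restrict_space_iff)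
        have "(\<lambda>y. indicator ?B y *\<^sub>R (indicator \<Omega> y *\<^sub>R f y)) \<in> borel_measurable lebesgue"
          by (rule borel_measurable_scaleR[OF borel_measurable_indicator[OF Bm(1)] *])
        moreover have "(\<lambda>y. indicator ?B y *\<^sub>R (indicator \<Omega> y *\<^sub>R f y)) = (\<lambda>y. indicator ?B y *\<^sub>R f y)"
          using sub by (auto simp: indicator_def fun_eq_iff)
        ultimately show ?thesis by simp
      qed
      have fg: "(LINT y:?B|lebesgue. f y) = (LINT y:?B|lebesgue. g y)"
        unfolding set_lebesgue_integral_def
      proof (rule integral_cong_AE[OF fm])
        show "(\<lambda>y. indicator ?B y *\<^sub>R g y) \<in> borel_measurable lebesgue"
          using gi unfolding set_integrable_def by (rule borel_measurable_integrable)
        show "AE y in lebesgue. indicator ?B y *\<^sub>R f y = indicator ?B y *\<^sub>R g y"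
          using ae by eventually_elim (use sub in \<open>auto simp: indicator_def\<close>)
      qed
      have constint: "(LINT y:?B|lebesgue. c) = (2*r) *\<^sub>R c" for c :: "'c::euclidean_space"
      proof -
        have "integrable lebesgue (indicator ?B :: real \<Rightarrow> real)"
          using Bm by (simp add: fmeasurable_def)
        then show ?thesis
          unfolding set_lebesgue_integral_def by (subst integral_scaleR_left) (simp_all add: mB)
      qed
      have cint: "(LINT y:?B|lebesgue. g x) = (2*r) *\<^sub>R g x"
        using constint .
      have dif: "set_integrable lebesgue ?B (\<lambda>y. g y - g x)"
        using gi ci by (rule set_integral_diff)
      have "norm ((LINT y:?B|lebesgue. g y) - (2*r) *\<^sub>R g x) = norm (LINT y:?B|lebesgue. (g y - g x))"
        using set_integral_diff(2)[OF gi ci] cint by simp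
      also have "\<dots> \<le> (LINT y:?B|lebesgue. norm (g y - g x))"
        using dif by (rule set_integral_norm_bound)
      also have "\<dots> \<le> (LINT y:?B|lebesgue. e/2)"
      proof (rule set_integral_mono)
        show "set_integrable lebesgue ?B (\<lambda>y. norm (g y - g x))" using dif by (rule set_integrable_norm)
        show "set_integrable lebesgue ?B (\<lambda>y. e/2)"
          using Bm unfolding set_integrable_def by (auto simp: fmeasurable_def)
        show "norm (g y - g x) \<le> e/2" if "y \<in> ?B" for y
        proof -
          have "y \<in> \<Omega>" "dist y x < d2" using that sub(1) r by (auto simp: dist_commute)
          then show ?thesis using d2(2) by (fastforce simp: dist_norm)
        qed
      qed
      also have "\<dots> = r * e" using constint[of "e/2"] by simp
      finally have b: "norm ((LINT y:?B|lebesgue. g y) - (2*r) *\<^sub>R g x) \<le> r * e" .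
      have "avg r - g x = (1/(2*r)) *\<^sub>R ((LINT y:?B|lebesgue. g y) - (2*r) *\<^sub>R g x)"
        using r unfolding avg_def fg mB by (simp add: scaleR_diff_right)
      then have "norm (avg r - g x) = (1/(2*r)) * norm ((LINT y:?B|lebesgue. g y) - (2*r) *\<^sub>R g x)"
        using r by simp
      also have "\<dots> \<le> (1/(2*r)) * (r * e)" using b r by (intro mult_left_mono) auto
      also have "\<dots> = e/2" using r by simp
      finally show ?thesis using e by (simp add: dist_norm)
    qed
    then show "\<forall>\<^sub>F r in at_right 0. dist (avg r) (g x) < e"
      unfolding eventually_at_right_field using d1 d2 by (intro exI[of _ "min d1 d2"]) auto
  qed
  then show ?thesis
    unfolding precise_rep_def avg_def[symmetric] Let_def
    by (auto simp: tendsto_Lim)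
qed

end

theory Submission
  imports Defs
begin

text \<open>
  The tensor field agrees almost everywhere with a primitive \<open>Q\<close> of its weak derivative \<open>G\<close>; by
  closedness \<open>Q\<close> takes values in \<open>{v \<otimes>\<^sub>v v | norm v = 1}\<close> everywhere on \<open>\<Omega>\<close>. The map
  \<open>v \<mapsto> v \<otimes>\<^sub>v v\<close> is a covering of this set by the sphere and \<open>\<Omega>\<close> is an interval, so \<open>Q\<close> lifts to a
  continuous \<open>m\<close>. Differentiating \<open>Q m = m\<close> formally, and using that \<open>m'\<close> is orthogonal to \<open>m\<close>, suggests
  \<open>m' = G m\<close>. An exact secant version of this computation shows that \<open>m\<close> is a primitive of \<open>G m\<close>,
  which is dominated by \<open>G\<close> and hence locally in \<open>L\<^sup>p\<close>.
\<close>

section \<open>Smooth cutoff functions\<close>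

text \<open>The sign of \<open>n\<close> may jump arbitrarily, even nonmeasurably, so
  \<open>n\<close> itself carries no regularity; only the sign-blind tensor field does. Choosing
  signs coherently is a topological task and asks for a field that is continuous at every point,
  whereas the hypothesis speaks of \<open>n\<close> only through integrals. Passing from one to the
  other is the analytic half of the proof. Weak derivatives are tested against smooth functions of
  compact support alone, so such functions are built by hand from exp(-1/t).

  The second obstacle is that \<open>Q\<close> and \<open>m\<close> come without pointwise
  derivatives. Differential identities are therefore proved as statements about increments: two
  functions agree up to a constant if, over short intervals, their increments differ by at most any
  prescribed multiple of the increment of one fixed control function. This single principle yields
  both integration by parts and the formula for the derivative of the lift.\<close>

definition flat :: "real poly \<Rightarrow> real \<Rightarrow> real"
  where "flat P t = (if t > 0 then poly P (1/t) * exp (- (1/t)) else 0)"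

lemma poly_exp_minus_tendsto_0: "((\<lambda>u. poly P u * exp (-u)) \<longlongrightarrow> (0::real)) at_top"
proof -
  have "((\<lambda>u. \<Sum>i\<le>degree P. coeff P i * (u ^ i / exp u)) \<longlongrightarrow> (\<Sum>i\<le>degree P. coeff P i * 0)) at_top"
    by (intro tendsto_sum tendsto_mult tendsto_const tendsto_power_div_exp_0)
  moreover have "poly P u * exp (-u) = (\<Sum>i\<le>degree P. coeff P i * (u ^ i / exp u))" for u :: real
    by (simp add: poly_altdef sum_distrib_right exp_minus divide_inverse mult.assoc)
  ultimately show ?thesis by simp
qed

lemma flat_tendsto_0: "(flat P \<longlongrightarrow> 0) (at 0)"
proof -
  have "((\<lambda>t. poly P (inverse t) * exp (- inverse t)) \<longlongrightarrow> (0::real)) (at_right 0)"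
    using filterlim_compose[OF poly_exp_minus_tendsto_0 filterlim_inverse_at_top_right] .
  then have r: "(flat P \<longlongrightarrow> 0) (at_right 0)"
    by (rule Lim_transform_eventually)
       (auto simp: eventually_at_right_field flat_def divide_inverse intro!: exI[of _ 1])
  have "((\<lambda>t. 0::real) \<longlongrightarrow> 0) (at_left 0)" by simp
  then have l: "(flat P \<longlongrightarrow> 0) (at_left 0)"
    by (rule Lim_transform_eventually)
       (auto simp: eventually_at_left_field flat_def intro!: exI[of _ "-1"])
  show ?thesis using l r by (simp add: filterlim_at_split)
qed

text \<open>With u = 1/t the chain rule contributes the factor -u^2, which turns P(u) exp(-u) into
  u^2 (P - P')(u) exp(-u), and \<open>[:0,0,1:]\<close> is u^2. Hence the family \<open>flat\<close>
  is closed under differentiation.\<close>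

lemma flat_has_derivative:
  "(flat P has_real_derivative flat ([:0,0,1:] * (P - pderiv P)) t) (at t)"
proof (cases t "0::real" rule: linorder_cases)
  case less
  have "((\<lambda>t. 0::real) has_real_derivative 0) (at t)" by simp
  then have "(flat P has_real_derivative 0) (at t)"
    by (rule has_field_derivative_transform_within_open[of _ _ _ "{..<0}"]) (use less in \<open>auto simp: flat_def\<close>)
  then show ?thesis using less by (simp add: flat_def)
next
  case greater
  have "((\<lambda>t. poly P (1/t) * exp (- (1/t))) has_real_derivative
      poly ([:0,0,1:] * (P - pderiv P)) (1/t) * exp (- (1/t))) (at t)"
  proof -
    have u: "((\<lambda>t. 1/t) has_real_derivative - (1/t)\<^sup>2) (at t)"
      using greater by (auto intro!: derivative_eq_intros simp: power2_eq_square)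
    have "((\<lambda>t. exp (- (1/t))) has_real_derivative exp (- (1/t)) * (1/t)\<^sup>2) (at t)"
      using DERIV_chain2[OF DERIV_exp DERIV_minus[OF u]] by simp
    from DERIV_mult[OF DERIV_chain2[OF poly_DERIV u] this] show ?thesis
      by (simp add: algebra_simps power2_eq_square)
  qed
  then have "(flat P has_real_derivative poly ([:0,0,1:] * (P - pderiv P)) (1/t) * exp (- (1/t))) (at t)"
    by (rule has_field_derivative_transform_within_open[of _ _ _ "{0<..}"]) (use greater in \<open>auto simp: flat_def\<close>)
  then show ?thesis using greater by (simp add: flat_def)
next
  case equal
  \<comment> \<open>Prepending a zero coefficient multiplies by 1/t, so
    \<open>flat (pCons 0 P)\<close> is the difference quotient of \<open>flat P\<close> at
    0.\<close>
  have "((\<lambda>h. flat (pCons 0 P) h) \<longlongrightarrow> 0) (at 0)" by (rule flat_tendsto_0)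
  then have "((\<lambda>h. (flat P (0 + h) - flat P 0) / h) \<longlongrightarrow> 0) (at 0)"
    by (rule Lim_transform_eventually) (auto simp: flat_def eventually_at intro!: exI[of _ 1])
  then show ?thesis using equal by (simp add: DERIV_def flat_def)
qed

text \<open>
  An inductively generated class that is closed under differentiation, so that smoothness of all
  the test functions below can be read off from the way they are built.
\<close>

inductive_set smooth_functions :: "(real \<Rightarrow> real) set" where
  flat: "flat P \<in> smooth_functions"
| const: "(\<lambda>x. c) \<in> smooth_functions"
| add: "f \<in> smooth_functions \<Longrightarrow> g \<in> smooth_functions \<Longrightarrow> (\<lambda>x. f x + g x) \<in> smooth_functions"
| mult: "f \<in> smooth_functions \<Longrightarrow> g \<in> smooth_functions \<Longrightarrow> (\<lambda>x. f x * g x) \<in> smooth_functions"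
| affine: "f \<in> smooth_functions \<Longrightarrow> (\<lambda>x. f (c * x + d)) \<in> smooth_functions"
| antiderivative:
    "f \<in> smooth_functions \<Longrightarrow> (\<And>x. (F has_real_derivative f x) (at x)) \<Longrightarrow> F \<in> smooth_functions"

lemma smooth_functions_has_derivative:
  assumes "f \<in> smooth_functions"
  shows "\<exists>g\<in>smooth_functions. \<forall>x. (f has_real_derivative g x) (at x)"
  using assms
proof induction
  case (flat P)
  then show ?case using flat_has_derivative smooth_functions.flat by blast
next
  case (const c)
  then show ?case by (intro bexI[OF _ smooth_functions.const[of 0]]) auto
next
  case (add f g)
  then obtain f' g' where "f' \<in> smooth_functions" "g' \<in> smooth_functions"
    and d: "\<And>x. (f has_real_derivative f' x) (at x)" "\<And>x. (g has_real_derivative g' x) (at x)" by blast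
  then show ?case
    by (intro bexI[OF _ smooth_functions.add[of f' g']]) (auto intro!: derivative_eq_intros)
next
  case (mult f g)
  then obtain f' g' where "f' \<in> smooth_functions" "g' \<in> smooth_functions"
    and d: "\<And>x. (f has_real_derivative f' x) (at x)" "\<And>x. (g has_real_derivative g' x) (at x)" by blast
  then show ?case using mult.hyps
    by (intro bexI[OF _ smooth_functions.add[OF smooth_functions.mult[of f' g] smooth_functions.mult[of f g']]])
       (auto intro!: derivative_eq_intros)
next
  case (affine f c d)
  then obtain f' where "f' \<in> smooth_functions" and f': "\<And>x. (f has_real_derivative f' x) (at x)" by blast
  moreover have "((\<lambda>x. f (c * x + d)) has_real_derivative c * f' (c * x + d)) (at x)" for x
  proof -
    have "((\<lambda>x. c * x + d) has_real_derivative c) (at x)" by (auto intro!: derivative_eq_intros)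
    from DERIV_chain2[OF f' this] show ?thesis by (simp add: mult.commute)
  qed
  ultimately show ?case
    by (intro bexI[OF _ smooth_functions.mult[OF smooth_functions.const[of c] smooth_functions.affine[of f' c d]]])
       auto
next
  case (antiderivative f F)
  then show ?case by blast
qed

lemma smooth_functions_higher_deriv:
  assumes "f \<in> smooth_functions"
  shows "(deriv ^^ k) f \<in> smooth_functions"
proof (induction k)
  case (Suc k)
  then obtain g where "g \<in> smooth_functions" "\<And>x. ((deriv ^^ k) f has_real_derivative g x) (at x)"
    using smooth_functions_has_derivative by blast
  moreover from this have "deriv ((deriv ^^ k) f) = g" using DERIV_imp_deriv by blast
  ultimately show ?case by simp
qed (use assms in simp)

lemma smooth_functions_differentiable:
  assumes "f \<in> smooth_functions"
  shows "(deriv ^^ k) f differentiable (at x)"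
  using smooth_functions_has_derivative[OF smooth_functions_higher_deriv[OF assms]]
  by (auto simp: real_differentiable_def)

text \<open>For negative t the interval \<open>{0..t}\<close> is empty and the integral is 0 rather
  than an oriented integral. Since \<open>r\<close> vanishes there, it is nevertheless an
  antiderivative on the whole line.\<close>

lemma DERIV_integral_vanishing_left:
  fixes r :: "real \<Rightarrow> real"
  assumes cont: "continuous_on UNIV r" and z: "\<And>t. t \<le> 0 \<Longrightarrow> r t = 0"
  shows "((\<lambda>t. integral {0..t} r) has_real_derivative r t) (at t)"
proof -
  \<comment> \<open>A base point left of both 0 and \<open>t\<close> makes \<open>t\<close>
    interior, so the derivative within the interval is a full derivative.\<close>
  define a where "a = min 0 t - 1"
  have eq: "integral {a..u} r = integral {0..u} r" if "a < u" for u
  proof -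
    have "integral {a..u} r = integral {a..u} (\<lambda>x. if x \<in> {0..u} then r x else 0)"
      by (rule integral_cong) (auto simp: z)
    also have "\<dots> = integral {0..u} r"
      using integral_restrict_Int[of "{a..u}" "{0..u}" r] by (simp add: a_def Int_absorb1)
    finally show ?thesis .
  qed
  have "((\<lambda>u. integral {a..u} r) has_vector_derivative r t) (at t within {a..t+1})"
    by (rule integral_has_vector_derivative) (auto intro: continuous_on_subset[OF cont] simp: a_def)
  then have "((\<lambda>u. integral {a..u} r) has_vector_derivative r t) (at t)"
    by (subst (asm) at_within_interior) (auto simp: a_def)
  then have "((\<lambda>u. integral {a..u} r) has_real_derivative r t) (at t)"
    by (simp add: has_real_derivative_iff_has_vector_derivative)
  then show ?thesis
    by (rule has_field_derivative_transform_within_open[of _ _ _ "{a<..}"]) (auto simp: eq, simp add: a_def)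
qed

lemma smooth_functions_continuous:
  assumes "f \<in> smooth_functions"
  shows "continuous_on S f"
  using smooth_functions_has_derivative[OF assms]
  by (meson DERIV_isCont continuous_at_imp_continuous_on)

text \<open>\<open>E\<close> is a smoothed step and \<open>A\<close> the smoothed ramp above it.
  Beyond 1 the ramp has slope exactly 1, so the difference of two shifted ramps is eventually
  constant; differences of such plateaus can then have compact support.\<close>

lemma smooth_transition:
  obtains A E where "A \<in> smooth_functions" "E \<in> smooth_functions"
    "\<And>t. (A has_real_derivative E t) (at t)"
    "\<And>t. t \<le> 0 \<Longrightarrow> A t = 0" "\<And>t. t \<le> 0 \<Longrightarrow> E t = 0" "\<And>t. t \<ge> 1 \<Longrightarrow> E t = 1"
    "\<And>t. 0 \<le> E t" "\<And>t. E t \<le> 1" "\<And>s t. 1 \<le> s \<Longrightarrow> 1 \<le> t \<Longrightarrow> A t - A s = t - s"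
proof -
  \<comment> \<open>A bump that is positive exactly on (0,1). Writing 1 - t as
    \<open>(-1) * t + 1\<close> fits the rule \<open>affine\<close>.\<close>
  define \<rho> where "\<rho> t = flat 1 t * flat 1 ((-1) * t + 1)" for t
  have \<rho>s: "\<rho> \<in> smooth_functions"
    unfolding \<rho>_def[abs_def] by (intro smooth_functions.intros)
  have \<rho>0: "\<rho> t = 0" if "t \<le> 0 \<or> t \<ge> 1" for t using that by (auto simp: \<rho>_def flat_def)
  have \<rho>pos: "\<rho> t \<ge> 0" for t by (auto simp: \<rho>_def flat_def)
  have \<rho>c: "continuous_on S \<rho>" for S using \<rho>s by (rule smooth_functions_continuous)
  have \<rho>i: "\<rho> integrable_on {a..b}" for a b by (rule integrable_continuous_interval[OF \<rho>c])
  define c where "c = integral {0..1} \<rho>"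
  have "c \<ge> 0" unfolding c_def by (rule integral_nonneg[OF \<rho>i \<rho>pos])
  have "c \<noteq> 0"
  proof
    assume "c = 0"
    then have "\<rho> (1/2) = 0"
      unfolding c_def using integral_eq_0_iff[of 0 1 \<rho>, OF \<rho>c] \<rho>pos by auto
    then show False by (simp add: \<rho>_def flat_def)
  qed
  with \<open>c \<ge> 0\<close> have c: "c > 0" by simp
  define E where "E t = (1/c) * integral {0..t} \<rho>" for t
  have E: "(E has_real_derivative (1/c) * \<rho> t) (at t)" for t
    unfolding E_def[abs_def]
    by (intro DERIV_cmult DERIV_integral_vanishing_left \<rho>c) (use \<rho>0 in auto)
  have Es: "E \<in> smooth_functions"
    by (rule smooth_functions.antiderivative[OF smooth_functions.mult[OF smooth_functions.const \<rho>s] E])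
  have E0: "E t = 0" if "t \<le> 0" for t using that by (cases "t = 0") (auto simp: E_def)
  have E1: "E t = 1" if "t \<ge> 1" for t
  proof -
    have "integral {1..t} \<rho> = integral {1..t} (\<lambda>x. 0)" by (rule integral_cong) (use \<rho>0 in auto)
    moreover have "integral {0..1} \<rho> + integral {1..t} \<rho> = integral {0..t} \<rho>"
      by (rule Henstock_Kurzweil_Integration.integral_combine) (use that \<rho>i in auto)
    ultimately show ?thesis using c by (simp add: E_def c_def)
  qed
  have Epos: "E t \<ge> 0" for t unfolding E_def using c by (intro mult_nonneg_nonneg integral_nonneg \<rho>i \<rho>pos) auto
  have Emono: "E s \<le> E t" if "s \<le> t" for s t
    by (rule DERIV_nonneg_imp_nondecreasing[OF that]) (use E \<rho>pos c in \<open>fastforce\<close>)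
  have Ele: "E t \<le> 1" for t using Emono[of t "max t 1"] E1[of "max t 1"] by simp
  define A where "A t = integral {0..t} E" for t
  have A: "(A has_real_derivative E t) (at t)" for t
    unfolding A_def[abs_def]
    by (intro DERIV_integral_vanishing_left smooth_functions_continuous[OF Es]) (use E0 in auto)
  have A0: "A t = 0" if "t \<le> 0" for t using that by (cases "t = 0") (auto simp: A_def)
  have A1: "A t = A 1 + (t - 1)" if "1 \<le> t" for t
  proof -
    have Ei: "E integrable_on {a..b}" for a b
      by (rule integrable_continuous_interval[OF smooth_functions_continuous[OF Es]])
    have "integral {1..t} E = integral {1..t} (\<lambda>x. 1)" by (rule integral_cong) (use E1 in auto)
    moreover have "integral {0..1} E + integral {1..t} E = integral {0..t} E"
      by (rule Henstock_Kurzweil_Integration.integral_combine) (use that Ei in auto)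
    ultimately show ?thesis using that by (simp add: A_def)
  qed
  have A2: "A t - A s = t - s" if "1 \<le> s" "1 \<le> t" for s t
    using A1[OF that(1)] A1[OF that(2)] by simp
  show thesis
    by (rule that[OF smooth_functions.antiderivative[OF Es A] Es A A0 E0 E1 Epos Ele A2])
qed

section \<open>Primitives and weak derivatives\<close>

text \<open>The bound adds up over adjacent intervals, so it passes from short intervals to
  \<open>{a..b}\<close> with the same \<open>e\<close>, and \<open>e\<close> is arbitrary. This
  stands in for "derivative zero implies constant" where no pointwise derivative is
  available.\<close>

lemma eq_if_increments_small:
  fixes R :: "real \<Rightarrow> 'b::real_normed_vector" and V :: "real \<Rightarrow> real"
  assumes "a \<le> b"
    and loc: "\<And>e. e > 0 \<Longrightarrow> \<exists>d>0. \<forall>u v. a \<le> u \<and> u \<le> v \<and> v \<le> b \<and> v - u < d \<longrightarrow>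
      norm (R v - R u) \<le> e * (V v - V u)"
  shows "R b = R a"
proof -
  have bound: "norm (R b - R a) \<le> e * (V b - V a)" if e: "e > 0" for e
  proof -
    obtain d where d: "d > 0"
      and d': "\<forall>u v. a \<le> u \<and> u \<le> v \<and> v \<le> b \<and> v - u < d \<longrightarrow> norm (R v - R u) \<le> e * (V v - V u)"
      using loc[OF e] by blast
    have *: "\<And>u v. a \<le> u \<Longrightarrow> u \<le> v \<Longrightarrow> v \<le> b \<Longrightarrow> v - u < d \<Longrightarrow> norm (R v - R u) \<le> e * (V v - V u)"
      using d' by blast
    \<comment> \<open>Chaining proceeds in pieces of length \<open>d/2\<close>, because the local
      bound asks for length strictly below \<open>d\<close>.\<close>
    have **: "norm (R v - R u) \<le> e * (V v - V u)"
      if "a \<le> u" "u \<le> v" "v \<le> b" "v - u \<le> real k * (d/2)" for u v k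
      using that
    proof (induction k arbitrary: v)
      case 0
      then show ?case using *[of u v] d by simp
    next
      case (Suc k)
      define w where "w = max u (v - d/2)"
      have "norm (R w - R u) \<le> e * (V w - V u)"
        by (rule Suc.IH) (use Suc.prems d in \<open>auto simp: w_def max_def algebra_simps\<close>)
      moreover have "norm (R v - R w) \<le> e * (V v - V w)"
        by (rule *) (use Suc.prems d in \<open>auto simp: w_def\<close>)
      moreover have "norm (R v - R u) \<le> norm (R v - R w) + norm (R w - R u)"
        using norm_triangle_ineq[of "R v - R w" "R w - R u"] by simp
      ultimately show ?case by (simp add: algebra_simps)
    qed
    obtain k :: nat where "b - a \<le> real k * (d/2)"
      using real_arch_simple[of "(b - a) / (d/2)"] d by (auto simp: field_simps)
    then show ?thesis using **[of a b k] \<open>a \<le> b\<close> by simp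
  qed
  \<comment> \<open>\<open>V\<close> is not assumed monotone: a nonpositive total increment is
    settled with \<open>e = 1\<close>, a positive one by rescaling \<open>e\<close>.\<close>
  have "norm (R b - R a) \<le> 0"
  proof (cases "V b - V a \<le> 0")
    case True
    then show ?thesis by (intro order_trans[OF bound[OF zero_less_one]]) simp
  next
    case False
    show ?thesis
    proof (rule field_le_epsilon)
      fix e :: real assume "e > 0"
      then show "norm (R b - R a) \<le> 0 + e"
        using bound[of "e / (V b - V a)"] False by simp
    qed
  qed
  then show ?thesis by simp
qed

text \<open>Local absolute continuity, encoded by the fundamental theorem of calculus on compact
  subintervals instead of by derivatives almost everywhere.\<close>

definition is_primitive_on :: "real set \<Rightarrow> (real \<Rightarrow> 'b::euclidean_space) \<Rightarrow> (real \<Rightarrow> 'b) \<Rightarrow> bool"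
  where "is_primitive_on S F f \<longleftrightarrow>
    (\<forall>x y. x \<le> y \<longrightarrow> {x..y} \<subseteq> S \<longrightarrow> f absolutely_integrable_on {x..y} \<and> F y - F x = integral {x..y} f)"

lemma is_primitive_onD:
  assumes "is_primitive_on S F f" "x \<le> y" "{x..y} \<subseteq> S"
  shows "f absolutely_integrable_on {x..y}" "F y - F x = integral {x..y} f"
  using assms by (auto simp: is_primitive_on_def)

lemma is_primitive_on_subset:
  "is_primitive_on S F f \<Longrightarrow> T \<subseteq> S \<Longrightarrow> is_primitive_on T F f"
  by (auto simp: is_primitive_on_def)

lemma is_primitive_on_Icc_continuous:
  assumes "is_primitive_on {a..b} F f"
  shows "continuous_on {a..b} F"
proof (cases "a \<le> b")
  case True
  have "f integrable_on {a..b}"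
    using is_primitive_onD(1)[OF assms True] set_lebesgue_integral_eq_integral(1) by blast
  then have "continuous_on {a..b} (\<lambda>x. F a + integral {a..x} f)"
    by (intro continuous_intros indefinite_integral_continuous_1)
  moreover have "F a + integral {a..x} f = F x" if "x \<in> {a..b}" for x
    using is_primitive_onD(2)[OF assms, of a x] that by (simp add: algebra_simps)
  ultimately show ?thesis by (rule continuous_on_eq)
qed simp

lemma open_contains_Icc_around:
  fixes x :: real
  assumes "open S" "x \<in> S"
  obtains a b where "a < x" "x < b" "{a..b} \<subseteq> S"
proof -
  obtain e where "e > 0" "cball x e \<subseteq> S" using assms open_contains_cball by blast
  then show thesis by (intro that[of "x - e" "x + e"]) (auto simp: cball_eq_atLeastAtMost)
qed

lemma is_primitive_on_continuous:
  assumes "is_primitive_on S F f" "open S"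
  shows "continuous_on S F"
proof (rule continuous_at_imp_continuous_on, rule)
  fix x assume "x \<in> S"
  then obtain a b where ab: "a < x" "x < b" "{a..b} \<subseteq> S" using open_contains_Icc_around assms(2) by blast
  have "continuous_on {a..b} F"
    by (rule is_primitive_on_Icc_continuous[OF is_primitive_on_subset[OF assms(1) ab(3)]])
  then show "isCont F x" by (rule continuous_on_interior) (use ab in auto)
qed

lemma primitive_exists:
  assumes "connected S" and f: "\<And>a b. {a..b} \<subseteq> S \<Longrightarrow> f absolutely_integrable_on {a..b}"
  obtains F where "is_primitive_on S F f"
proof (cases "S = {}")
  case True
  then show thesis by (intro that[of "\<lambda>_. 0"]) (auto simp: is_primitive_on_def)
next
  case False
  then obtain z where z: "z \<in> S" by blast
  define F where "F x = integral {z..x} f - integral {x..z} f" for x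
    \<comment> \<open>at most one of the two intervals is nondegenerate\<close>
  have comb: "integral {a..c} f + integral {c..b} f = integral {a..b} f"
    if "a \<le> c" "c \<le> b" "a \<in> S" "b \<in> S" for a b c
    using that f[of a b] connected_contains_Icc[OF assms(1), of a b]
    by (intro Henstock_Kurzweil_Integration.integral_combine) (auto dest: set_lebesgue_integral_eq_integral(1))
  have "F y - F x = integral {x..y} f" if "x \<le> y" "{x..y} \<subseteq> S" for x y
  proof -
    have xy: "x \<in> S" "y \<in> S" using that by auto
    consider "z \<le> x" | "x < z" "z < y" | "y \<le> z" by linarith
    then show ?thesis
    proof cases
      case 1
      moreover have "integral {u..z} f = 0" if "z \<le> u" for u using that by (cases "u = z") auto
      ultimately show ?thesis using comb[of z x y] that xy z by (auto simp: F_def algebra_simps)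
    next
      case 2
      then show ?thesis using comb[of x z y] that xy z by (auto simp: F_def algebra_simps)
    next
      case 3
      moreover have "integral {z..u} f = 0" if "u \<le> z" for u using that by (cases "u = z") auto
      ultimately show ?thesis using comb[of x y z] that xy z by (auto simp: F_def algebra_simps)
    qed
  qed
  then show thesis by (intro that[of F]) (simp add: is_primitive_on_def f)
qed

section \<open>Absolute integrability on compact intervals and integration by parts\<close>

lemma absolutely_integrable_on_Icc_subset:
  fixes f :: "real \<Rightarrow> 'b::euclidean_space"
  assumes "f absolutely_integrable_on {a..b}" "a \<le> u" "v \<le> b"
  shows "f absolutely_integrable_on {u..v}"
  by (rule absolutely_integrable_on_subinterval[OF assms(1)]) (use assms in auto)

lemma absolutely_integrable_continuous_scaleR:
  fixes f :: "real \<Rightarrow> 'b::euclidean_space"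
  assumes "continuous_on {a..b} \<phi>" "f absolutely_integrable_on {a..b}"
  shows "(\<lambda>x. \<phi> x *\<^sub>R f x) absolutely_integrable_on {a..b}"
proof (rule absolutely_integrable_bounded_measurable_product[where h="(*\<^sub>R)", OF _ _ _ _ assms(2)])
  show "bilinear ((*\<^sub>R) :: real \<Rightarrow> 'b \<Rightarrow> 'b)"
    using bounded_bilinear_scaleR bilinear_conv_bounded_bilinear by blast
  show "\<phi> \<in> borel_measurable (lebesgue_on {a..b})"
    by (intro continuous_imp_measurable_on_sets_lebesgue assms(1)) auto
  show "bounded (\<phi> ` {a..b})"
    by (intro compact_imp_bounded compact_continuous_image assms(1)) auto
qed auto

lemma integral_diff_Icc:
  fixes f :: "real \<Rightarrow> 'b::euclidean_space"
  assumes "f absolutely_integrable_on {a..b}" "a \<le> u" "u \<le> v" "v \<le> b"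
  shows "integral {a..v} f - integral {a..u} f = integral {u..v} f"
proof -
  have "integral {a..u} f + integral {u..v} f = integral {a..v} f"
    using assms absolutely_integrable_on_Icc_subset[OF assms(1), of a v]
    by (intro Henstock_Kurzweil_Integration.integral_combine) (auto dest: set_lebesgue_integral_eq_integral(1))
  then show ?thesis by (simp add: algebra_simps)
qed

text \<open>
  No almost everywhere differentiability is needed: over a short interval \<open>{u..v}\<close> the increments of
  the two sides differ by the integral of \<open>\<psi> t *\<^sub>R (f v - f t) + (\<phi> u - \<phi> t) *\<^sub>R g t\<close>, which is small
  compared to that of \<open>norm (\<psi> t) + norm (g t)\<close>.
\<close>

lemma integral_by_parts_primitive:
  fixes f g :: "real \<Rightarrow> 'b::euclidean_space" and \<phi> \<psi> :: "real \<Rightarrow> real"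
  assumes "a \<le> b" and f: "is_primitive_on {a..b} f g"
    and \<phi>: "\<And>x. (\<phi> has_real_derivative \<psi> x) (at x)" and \<psi>: "continuous_on UNIV \<psi>"
  shows "integral {a..b} (\<lambda>x. \<psi> x *\<^sub>R f x + \<phi> x *\<^sub>R g x) = \<phi> b *\<^sub>R f b - \<phi> a *\<^sub>R f a"
proof -
  have cf: "continuous_on {a..b} f" by (rule is_primitive_on_Icc_continuous[OF f])
  have c\<phi>: "continuous_on S \<phi>" for S using \<phi> by (meson DERIV_isCont continuous_at_imp_continuous_on)
  have c\<psi>: "continuous_on S \<psi>" for S using \<psi> continuous_on_subset by blast
  have ig: "g absolutely_integrable_on {a..b}" using is_primitive_onD(1)[OF f] \<open>a \<le> b\<close> by simp
  define h where "h x = \<psi> x *\<^sub>R f x + \<phi> x *\<^sub>R g x" for x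
  define k where "k x = norm (\<psi> x) + norm (g x)" for x
  have ih: "h absolutely_integrable_on {a..b}"
    unfolding h_def[abs_def]
    by (intro set_integral_add absolutely_integrable_continuous_scaleR absolutely_integrable_continuous_real c\<phi> c\<psi> cf ig)
  have ik: "k absolutely_integrable_on {a..b}"
    unfolding k_def[abs_def]
    by (intro set_integral_add absolutely_integrable_norm[unfolded o_def] absolutely_integrable_continuous_real c\<psi> ig)
  define R where "R x = \<phi> x *\<^sub>R f x - integral {a..x} h" for x
  have "R b = R a"
  proof (rule eq_if_increments_small[where V="\<lambda>x. integral {a..x} k", OF \<open>a \<le> b\<close>])
    fix e :: real assume e: "e > 0"
    have "uniformly_continuous_on {a..b} f" "uniformly_continuous_on {a..b} \<phi>"
      using cf c\<phi> by (auto intro: compact_uniformly_continuous)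
    then obtain d1 d2 where d1: "d1 > 0" "\<And>x y. x \<in> {a..b} \<Longrightarrow> y \<in> {a..b} \<Longrightarrow> dist y x < d1 \<Longrightarrow> dist (f y) (f x) < e"
      and d2: "d2 > 0" "\<And>x y. x \<in> {a..b} \<Longrightarrow> y \<in> {a..b} \<Longrightarrow> dist y x < d2 \<Longrightarrow> dist (\<phi> y) (\<phi> x) < e"
      unfolding uniformly_continuous_on_def using e by metis
    have "norm (R v - R u) \<le> e * (integral {a..v} k - integral {a..u} k)"
      if uv: "a \<le> u" "u \<le> v" "v \<le> b" "v - u < min d1 d2" for u v
    proof -
      have hi: "h integrable_on {u..v}" and ki: "k integrable_on {u..v}" and gi: "g integrable_on {u..v}"
        using uv absolutely_integrable_on_Icc_subset[OF ih, of u v] absolutely_integrable_on_Icc_subset[OF ik, of u v]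
          absolutely_integrable_on_Icc_subset[OF ig, of u v] by (simp_all add: set_lebesgue_integral_eq_integral(1))
      have p: "(\<psi> has_integral \<phi> v - \<phi> u) {u..v}"
        using uv(2) \<phi> by (intro fundamental_theorem_of_calculus)
          (auto simp: has_real_derivative_iff_has_vector_derivative intro: has_vector_derivative_at_within)
      have p': "(g has_integral f v - f u) {u..v}"
        using is_primitive_onD(2)[OF f, of u v] uv integrable_integral[OF gi] by auto
      \<comment> \<open>Discrete product rule: with \<open>f\<close> frozen at \<open>v\<close> and
        \<open>\<phi>\<close> at \<open>u\<close>, the first two terms integrate exactly to the
        increment of \<open>\<phi> x *\<^sub>R f x\<close>.\<close>
      have "((\<lambda>t. \<psi> t *\<^sub>R f v + \<phi> u *\<^sub>R g t - h t) has_integral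
          ((\<phi> v - \<phi> u) *\<^sub>R f v + \<phi> u *\<^sub>R (f v - f u) - integral {u..v} h)) {u..v}"
        by (intro has_integral_diff has_integral_add has_integral_cmul p' integrable_integral hi
            has_integral_scaleR_left[OF p])
      moreover have "(\<phi> v - \<phi> u) *\<^sub>R f v + \<phi> u *\<^sub>R (f v - f u) - integral {u..v} h = R v - R u"
        using integral_diff_Icc[OF ih uv(1-3)] by (simp add: R_def algebra_simps)
      ultimately have I: "((\<lambda>t. \<psi> t *\<^sub>R f v + \<phi> u *\<^sub>R g t - h t) has_integral (R v - R u)) {u..v}" by simp
      have "norm (integral {u..v} (\<lambda>t. \<psi> t *\<^sub>R f v + \<phi> u *\<^sub>R g t - h t)) \<le> integral {u..v} (\<lambda>t. e * k t)"
      proof (rule Henstock_Kurzweil_Integration.integral_norm_bound_integral)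
        show "(\<lambda>t. \<psi> t *\<^sub>R f v + \<phi> u *\<^sub>R g t - h t) integrable_on {u..v}" using I by blast
        show "(\<lambda>t. e * k t) integrable_on {u..v}" using integrable_cmul[OF ki, of e] by simp
        fix t assume t: "t \<in> {u..v}"
        have "norm (f v - f t) \<le> e" "\<bar>\<phi> u - \<phi> t\<bar> \<le> e"
          using d1(2)[of t v] d2(2)[of t u] t uv by (auto simp: dist_norm)
        then have "norm (\<psi> t *\<^sub>R (f v - f t)) \<le> norm (\<psi> t) * e" "norm ((\<phi> u - \<phi> t) *\<^sub>R g t) \<le> e * norm (g t)"
          by (auto intro: mult_left_mono mult_right_mono)
        moreover have "\<psi> t *\<^sub>R f v + \<phi> u *\<^sub>R g t - h t = \<psi> t *\<^sub>R (f v - f t) + (\<phi> u - \<phi> t) *\<^sub>R g t"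
          by (simp add: h_def algebra_simps)
        ultimately show "norm (\<psi> t *\<^sub>R f v + \<phi> u *\<^sub>R g t - h t) \<le> e * k t"
          using norm_triangle_ineq[of "\<psi> t *\<^sub>R (f v - f t)" "(\<phi> u - \<phi> t) *\<^sub>R g t"]
          by (simp add: k_def algebra_simps)
      qed
      also have "integral {u..v} (\<lambda>t. e * k t) = e * (integral {a..v} k - integral {a..u} k)"
        using integral_diff_Icc[OF ik uv(1-3)] by simp
      finally show ?thesis using integral_unique[OF I] by simp
    qed
    then show "\<exists>d>0. \<forall>u v. a \<le> u \<and> u \<le> v \<and> v \<le> b \<and> v - u < d \<longrightarrow>
        norm (R v - R u) \<le> e * (integral {a..v} k - integral {a..u} k)"
      using d1 d2 by (intro exI[of _ "min d1 d2"]) auto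
  qed
  then show ?thesis by (simp add: R_def h_def[abs_def] algebra_simps)
qed

lemma set_lebesgue_integral_eq_integral_Icc:
  fixes h :: "real \<Rightarrow> 'b::euclidean_space"
  assumes "{a..b} \<subseteq> S" "h absolutely_integrable_on {a..b}" "\<And>x. x \<notin> {a..b} \<Longrightarrow> h x = 0"
  shows "(LINT x:S|lebesgue. h x) = integral {a..b} h"
proof -
  have "indicator S x *\<^sub>R h x = indicator {a..b} x *\<^sub>R h x" for x
    using assms by (cases "x \<in> {a..b}") (auto simp: indicator_def)
  then have "(LINT x:S|lebesgue. h x) = (LINT x:{a..b}|lebesgue. h x)"
    unfolding set_lebesgue_integral_def by presburger
  then show ?thesis using set_lebesgue_integral_eq_integral(2)[OF assms(2)] by simp
qed

section \<open>Test functions and the weak derivative of a primitive\<close>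

lemma test_function_has_derivative:
  assumes "test_function \<Omega> \<phi>"
  shows "(\<phi> has_real_derivative deriv \<phi> x) (at x)" "continuous_on S (deriv \<phi>)"
proof -
  have k: "(deriv ^^ k) \<phi> differentiable (at x)" for k x using assms by (simp add: test_function_def)
  show "(\<phi> has_real_derivative deriv \<phi> x) (at x)"
    using k[of 0] by (simp add: DERIV_deriv_iff_real_differentiable)
  show "continuous_on S (deriv \<phi>)"
    using k[of 1] by (auto intro!: continuous_at_imp_continuous_on differentiable_imp_continuous_within)
qed

text \<open>Reduces integrals over \<open>\<Omega>\<close> to one compact interval. As
  \<open>\<Omega>\<close> is open, the hull of the support can be widened slightly, so that
  \<open>\<phi>\<close> vanishes at both endpoints and boundary terms disappear.\<close>

lemma test_function_support:
  assumes t: "test_function \<Omega> \<phi>" and "open \<Omega>" "connected \<Omega>" "\<Omega> \<noteq> {}"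
  obtains a b where "a < b" "{a..b} \<subseteq> \<Omega>" "\<And>x. x \<notin> {a<..<b} \<Longrightarrow> \<phi> x = 0"
    "\<And>x. x \<notin> {a<..<b} \<Longrightarrow> deriv \<phi> x = 0"
proof -
  define K where "K = closure {x. \<phi> x \<noteq> 0}"
  \<comment> \<open>The support may be empty; adjoining a point of \<open>\<Omega>\<close>
    guarantees a least and a greatest element.\<close>
  obtain z where "z \<in> \<Omega>" using assms by blast
  have K: "compact (insert z K)" "insert z K \<subseteq> \<Omega>"
    using t \<open>z \<in> \<Omega>\<close> by (auto simp: test_function_def K_def)
  obtain s where s: "s \<in> insert z K" "\<And>x. x \<in> insert z K \<Longrightarrow> s \<le> x"
    using compact_attains_inf[OF K(1)] by auto
  obtain r where r: "r \<in> insert z K" "\<And>x. x \<in> insert z K \<Longrightarrow> x \<le> r"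
    using compact_attains_sup[OF K(1)] by auto
  obtain a a' where a: "a < s" "s < a'" "{a..a'} \<subseteq> \<Omega>"
    using open_contains_Icc_around[OF assms(2)] s(1) K(2) by blast
  obtain b b' where b: "b' < r" "r < b" "{b'..b} \<subseteq> \<Omega>"
    using open_contains_Icc_around[OF assms(2)] r(1) K(2) by blast
  have "a < b" using a b s r by fastforce
  moreover have "a \<in> \<Omega>" "b \<in> \<Omega>" using a b by auto
  then have "{a..b} \<subseteq> \<Omega>" using connected_contains_Icc[OF assms(3)] by blast
  moreover have x: "x \<notin> K" if "x \<notin> {a<..<b}" for x
    using that a(1) b(2) s(2)[of x] r(2)[of x] by auto
  moreover have z: "\<phi> x = 0" if "x \<notin> K" for x
    using that closure_subset[of "{x. \<phi> x \<noteq> 0}"] by (auto simp: K_def)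
  moreover have "deriv \<phi> x = 0" if "x \<notin> K" for x
  proof -
    have "open (- K)" by (simp add: K_def open_Compl)
    then have "(\<phi> has_real_derivative 0) (at x)"
      using that z by (intro has_field_derivative_transform_within_open[of "\<lambda>_. 0" 0 x "-K" \<phi>, OF DERIV_const]) auto
    then show ?thesis by (rule DERIV_imp_deriv)
  qed
  ultimately show thesis using that by blast
qed

text \<open>Serves twice: for the primitive that is compared with the tensor field, and at the end
  for the lift \<open>m\<close>.\<close>

lemma weak_derivative_on_primitive:
  assumes f: "is_primitive_on \<Omega> f g" and \<Omega>: "open \<Omega>" "connected \<Omega>" "\<Omega> \<noteq> {}"
  shows "weak_derivative_on \<Omega> f g"
  unfolding weak_derivative_on_def
proof (intro allI impI)
  fix \<phi> assume t: "test_function \<Omega> \<phi>"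
  obtain a b where ab: "a < b" "{a..b} \<subseteq> \<Omega>" "\<And>x. x \<notin> {a<..<b} \<Longrightarrow> \<phi> x = 0"
    "\<And>x. x \<notin> {a<..<b} \<Longrightarrow> deriv \<phi> x = 0" using test_function_support[OF t \<Omega>] by metis
  note d = test_function_has_derivative[OF t]
  have c: "continuous_on S \<phi>" for S using d(1) by (meson DERIV_isCont continuous_at_imp_continuous_on)
  have f': "is_primitive_on {a..b} f g" using is_primitive_on_subset[OF f ab(2)] .
  have i1: "(\<lambda>x. deriv \<phi> x *\<^sub>R f x) absolutely_integrable_on {a..b}"
    by (intro absolutely_integrable_continuous_real continuous_intros d(2) is_primitive_on_Icc_continuous[OF f'])
  have i2: "(\<lambda>x. \<phi> x *\<^sub>R g x) absolutely_integrable_on {a..b}"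
    using is_primitive_onD(1)[OF f'] ab by (intro absolutely_integrable_continuous_scaleR c) auto
  have "integral {a..b} (\<lambda>x. deriv \<phi> x *\<^sub>R f x) + integral {a..b} (\<lambda>x. \<phi> x *\<^sub>R g x)
      = integral {a..b} (\<lambda>x. deriv \<phi> x *\<^sub>R f x + \<phi> x *\<^sub>R g x)"
    using i1 i2 by (intro Henstock_Kurzweil_Integration.integral_add[symmetric])
      (auto dest: set_lebesgue_integral_eq_integral(1))
  also have "\<dots> = 0"
    using integral_by_parts_primitive[OF _ f' d(1) d(2)] ab by simp
  finally have "integral {a..b} (\<lambda>x. deriv \<phi> x *\<^sub>R f x) + integral {a..b} (\<lambda>x. \<phi> x *\<^sub>R g x) = 0" .
  moreover have "(LINT x:\<Omega>|lebesgue. deriv \<phi> x *\<^sub>R f x) = integral {a..b} (\<lambda>x. deriv \<phi> x *\<^sub>R f x)"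
    by (rule set_lebesgue_integral_eq_integral_Icc[OF ab(2) i1]) (use ab(4) in force)
  moreover have "(LINT x:\<Omega>|lebesgue. \<phi> x *\<^sub>R g x) = integral {a..b} (\<lambda>x. \<phi> x *\<^sub>R g x)"
    by (rule set_lebesgue_integral_eq_integral_Icc[OF ab(2) i2]) (use ab(3) in force)
  ultimately show "(LINT x:\<Omega>|lebesgue. deriv \<phi> x *\<^sub>R f x) = - (LINT x:\<Omega>|lebesgue. \<phi> x *\<^sub>R g x)"
    by (simp add: eq_neg_iff_add_eq_0)
qed

section \<open>The du Bois-Reymond lemma\<close>

text \<open>
  The test functions for the du Bois-Reymond lemma: differences of two smoothed ramps of equal
  height, so that the derivatives tend boundedly to a difference of normalised indicators.
\<close>

lemma plateau_difference_test_functions: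
  fixes a b a' b' :: real
  assumes "open \<Omega>" "connected \<Omega>" "a < b" "{a..b} \<subseteq> \<Omega>" "a' < b'" "{a'..b'} \<subseteq> \<Omega>"
  obtains N \<phi> C where "max b b' \<le> N" "{min a a'..N} \<subseteq> \<Omega>"
    "\<And>n. test_function \<Omega> (\<phi> n)" "\<And>n x. x \<notin> {min a a'..N} \<Longrightarrow> deriv (\<phi> n) x = 0"
    "\<And>n x. \<bar>deriv (\<phi> n) x\<bar> \<le> C"
    "\<And>x. (\<lambda>n. deriv (\<phi> n) x) \<longlonglongrightarrow> indicator {a<..b} x / (b - a) - indicator {a'<..b'} x / (b' - a')"
proof -
  obtain A E where A: "A \<in> smooth_functions" and Es: "E \<in> smooth_functions" and dA: "\<And>t. (A has_real_derivative E t) (at t)"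
    and A0: "\<And>t. t \<le> 0 \<Longrightarrow> A t = 0" and E0: "\<And>t. t \<le> 0 \<Longrightarrow> E t = 0" and E1: "\<And>t. t \<ge> 1 \<Longrightarrow> E t = 1"
    and Eb: "\<And>t. 0 \<le> E t" "\<And>t. E t \<le> 1" and A1: "\<And>s t. 1 \<le> s \<Longrightarrow> 1 \<le> t \<Longrightarrow> A t - A s = t - s"
    by (rule smooth_transition) blast
  define L where "L = min a a'"
  define M where "M = max b b'"
  have "L \<in> \<Omega>" "M \<in> \<Omega>" using assms by (auto simp: L_def M_def min_def max_def)
  \<comment> \<open>Each ramp starts exactly at its left end but overshoots its right end by up to
    1/\<kappa>, so extra room inside \<open>\<Omega>\<close> is reserved only to the right of
    \<open>M\<close>.\<close>
  then obtain M' N where N: "M' < M" "M < N" "{M'..N} \<subseteq> \<Omega>" using open_contains_Icc_around assms(1) by blast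
  then have "N \<in> \<Omega>" by auto
  with \<open>L \<in> \<Omega>\<close> have LN: "{L..N} \<subseteq> \<Omega>" by (rule connected_contains_Icc[OF assms(2)])
  \<comment> \<open>The steepness tends to infinity with \<open>n\<close>; the summand
    \<open>1 / (N - M)\<close> ensures that already for \<open>n = 0\<close> every transition is
    finished at \<open>N\<close>.\<close>
  define \<kappa> where "\<kappa> n = 1 / (N - M) + real n" for n
  have \<kappa>: "\<kappa> n > 0" "1 \<le> \<kappa> n * (N - M)" for n
  proof -
    have "1 / (N - M) > 0" using N by simp
    then show "\<kappa> n > 0" unfolding \<kappa>_def by (intro add_pos_nonneg) auto
    have "\<kappa> n * (N - M) = 1 + real n * (N - M)" using N by (simp add: \<kappa>_def distrib_right)
    then show "1 \<le> \<kappa> n * (N - M)" using N by simp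
  qed
  \<comment> \<open>A smoothed ramp from 0 at \<open>u\<close> to about \<open>v\<close>. The two
    copies of \<open>A\<close> differ finally by \<open>(v - u) * \<kappa> n\<close>, so the
    prefactor makes the height 1 for every \<open>u\<close> and \<open>v\<close>, and two such ramps
    cancel beyond \<open>N\<close>.\<close>
  define T where "T n u v x = 1 / ((v - u) * \<kappa> n) * (A (\<kappa> n * x + - (\<kappa> n * u)) + (-1) * A (\<kappa> n * x + - (\<kappa> n * v)))"
    for n u v x
  define \<phi> where "\<phi> n x = T n a b x + (-1) * T n a' b' x" for n x
  define S where "S n u v x = (E (\<kappa> n * (x - u)) - E (\<kappa> n * (x - v))) / (v - u)" for n u v x
  have Ts: "T n u v \<in> smooth_functions" for n u v
    unfolding T_def[abs_def] by (intro smooth_functions.intros(2-5) A)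
  have Td: "(T n u v has_real_derivative S n u v x) (at x)" for n u v x
  proof -
    have "((\<lambda>x. A (\<kappa> n * x + - (\<kappa> n * w))) has_real_derivative E (\<kappa> n * x + - (\<kappa> n * w)) * \<kappa> n) (at x)" for w
      by (rule DERIV_chain2[OF dA]) (auto intro!: derivative_eq_intros)
    note DERIV_cmult[OF DERIV_add[OF this[of u] DERIV_cmult[OF this[of v], of "-1"]], of "1 / ((v - u) * \<kappa> n)"]
    moreover have "1 / ((v - u) * \<kappa> n) * (E (\<kappa> n * x + - (\<kappa> n * u)) * \<kappa> n + (-1) * (E (\<kappa> n * x + - (\<kappa> n * v)) * \<kappa> n)) = S n u v x"
      using \<kappa>(1)[of n] by (cases "v = u") (simp_all add: S_def field_simps)
    ultimately show ?thesis unfolding T_def[abs_def] by simp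
  qed
  have \<phi>d: "deriv (\<phi> n) x = S n a b x - S n a' b' x" for n x
    unfolding \<phi>_def[abs_def] by (rule DERIV_imp_deriv) (auto intro!: derivative_eq_intros Td)
  have neg: "\<kappa> n * (x - w) \<le> 0" if "x \<le> w" for n x w
    using that \<kappa>(1)[of n] by (simp add: mult_nonneg_nonpos)
  have big: "1 \<le> \<kappa> n * (x - w)" if "N \<le> x" "w \<le> M" for n x w
    using \<kappa>(2)[of n] mult_left_mono[of "N - M" "x - w" "\<kappa> n"] that \<kappa>(1)[of n] by linarith
  have T0: "T n u v x = 0" if "x \<le> u" "u < v" for n u v x
    using A0[OF neg[of x u n]] A0[OF neg[of x v n]] that by (simp add: T_def algebra_simps)
  have T1: "T n u v x = 1" if "N \<le> x" "u < v" "v \<le> M" for n u v x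
  proof -
    have "A (\<kappa> n * x + - (\<kappa> n * u)) - A (\<kappa> n * x + - (\<kappa> n * v)) = (v - u) * \<kappa> n"
      using A1[OF big[of x v n] big[of x u n]] that by (simp add: algebra_simps)
    then have "T n u v x = 1 / ((v - u) * \<kappa> n) * ((v - u) * \<kappa> n)" by (simp add: T_def)
    then show ?thesis using that \<kappa>(1)[of n] by simp
  qed
  have S0: "S n u v x = 0" if "x \<le> u" "u < v" for n u v x
    using E0[OF neg[of x u n]] E0[OF neg[of x v n]] that by (simp add: S_def)
  have S1: "S n u v x = 0" if "N \<le> x" "u < v" "v \<le> M" for n u v x
    using E1[OF big[of x v n]] E1[OF big[of x u n]] that by (simp add: S_def)
  have \<phi>0: "\<phi> n x = 0" "deriv (\<phi> n) x = 0" if "x \<notin> {L..N}" for n x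
  proof -
    have "x \<le> L \<or> N \<le> x" using that by auto
    then show "\<phi> n x = 0" "deriv (\<phi> n) x = 0" using assms(3,5) T0 T1 S0 S1
      by (auto simp: \<phi>_def \<phi>d L_def M_def)
  qed
  have test: "test_function \<Omega> (\<phi> n)" for n
    unfolding test_function_def
  proof (intro conjI allI)
    have "\<phi> n \<in> smooth_functions" unfolding \<phi>_def[abs_def] by (intro smooth_functions.intros(2-4) Ts)
    then show "(deriv ^^ k) (\<phi> n) differentiable (at x)" for k x by (rule smooth_functions_differentiable)
    have sub: "closure {x. \<phi> n x \<noteq> 0} \<subseteq> {L..N}" using \<phi>0(1)[of _ n] by (intro closure_minimal) (blast, simp)
    show "closure {x. \<phi> n x \<noteq> 0} \<subseteq> \<Omega>" using sub LN by blast
    show "compact (closure {x. \<phi> n x \<noteq> 0})"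
      using sub by (meson bounded_closed_interval bounded_subset closed_closure compact_eq_bounded_closed)
  qed
  have bd: "\<bar>deriv (\<phi> n) x\<bar> \<le> 1 / (b - a) + 1 / (b' - a')" for n x
  proof -
    have "\<bar>S n u v x\<bar> \<le> 1 / (v - u)" if "u < v" for u v
    proof -
      have "\<bar>E (\<kappa> n * (x - u)) - E (\<kappa> n * (x - v))\<bar> \<le> 1" using Eb by (smt (verit))
      then show ?thesis using that by (simp add: S_def divide_right_mono)
    qed
    from this[OF assms(3)] this[OF assms(5)] show ?thesis unfolding \<phi>d by linarith
  qed
  have lim: "(\<lambda>n. S n u v x) \<longlonglongrightarrow> indicator {u<..v} x / (v - u)" if "u < v" for u v x
  proof -
    \<comment> \<open>As \<open>E\<close> vanishes at 0, the limit at \<open>x = w\<close> is 0;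
      this is why half-open intervals appear in the limit.\<close>
    have Elim: "(\<lambda>n. E (\<kappa> n * (x - w))) \<longlonglongrightarrow> (if w < x then 1 else 0)" for w
    proof (cases "w < x")
      case True
      have "\<forall>\<^sub>F n in sequentially. E (\<kappa> n * (x - w)) = 1"
      proof -
        obtain m :: nat where m: "1 / (x - w) \<le> real m" using real_arch_simple by blast
        have "E (\<kappa> n * (x - w)) = 1" if "n \<ge> m" for n
        proof (rule E1)
          have "1 / (x - w) \<le> \<kappa> n" using m that N by (simp add: \<kappa>_def) (smt (verit) divide_nonneg_pos of_nat_mono)
          then show "1 \<le> \<kappa> n * (x - w)" using True by (simp add: field_simps)
        qed
        then show ?thesis by (auto simp: eventually_sequentially)
      qed
      then show ?thesis using True by (simp add: tendsto_eventually)
    next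
      case False
      then show ?thesis using E0[OF neg[of x w]] by simp
    qed
    have "(\<lambda>n. S n u v x) \<longlonglongrightarrow> ((if u < x then 1 else 0) - (if v < x then 1 else 0)) / (v - u)"
      unfolding S_def using that by (intro tendsto_intros Elim) auto
    moreover have "(if u < x then 1 else 0) - (if v < x then 1 else 0) = (indicator {u<..v} x :: real)"
      using that by (auto simp: indicator_def)
    ultimately show ?thesis by simp
  qed
  show thesis
  proof (rule that[of N \<phi>])
    show "max b b' \<le> N" using N by (simp add: M_def)
    show "{min a a'..N} \<subseteq> \<Omega>" using LN by (simp add: L_def)
    show "deriv (\<phi> n) x = 0" if "x \<notin> {min a a'..N}" for n x using \<phi>0(2) that by (simp add: L_def)
    show "(\<lambda>n. deriv (\<phi> n) x) \<longlonglongrightarrow> indicator {a<..b} x / (b - a) - indicator {a'<..b'} x / (b' - a')" for x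
      unfolding \<phi>d using assms(3,5) by (intro tendsto_diff lim)
  qed (fact test bd)+
qed

lemma integral_indicator_Ioc:
  fixes h :: "real \<Rightarrow> 'b::euclidean_space"
  assumes "h absolutely_integrable_on {L..N}" "L \<le> a" "b \<le> N"
  shows "((\<lambda>x. (indicator {a<..b} x * r) *\<^sub>R h x) has_integral r *\<^sub>R integral {a..b} h) {L..N}"
proof -
  have "(h has_integral integral {a..b} h) {a..b}"
    using absolutely_integrable_on_Icc_subset[OF assms] by (intro integrable_integral set_lebesgue_integral_eq_integral)
  then have "((\<lambda>x. r *\<^sub>R h x) has_integral r *\<^sub>R integral {a..b} h) {a..b}" by (rule has_integral_cmul)
  then have "((\<lambda>x. if x \<in> {a..b} then r *\<^sub>R h x else 0) has_integral r *\<^sub>R integral {a..b} h) {L..N}"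
    using assms by (subst has_integral_restrict) auto
  then show ?thesis
    by (rule has_integral_spike[of "{a}", rotated 2]) (auto simp: indicator_def)
qed

text \<open>Tested against the plateau differences, \<open>h\<close> gives integral 0 for every
  \<open>n\<close>. A constant multiple of \<open>norm (h x)\<close> dominates, so the limit of the
  integrands also has integral 0, and that integral is the difference of the two averages.\<close>

lemma weak_derivative_zero_averages:
  fixes h :: "real \<Rightarrow> 'b::euclidean_space"
  assumes \<Omega>: "open \<Omega>" "connected \<Omega>"
    and h: "\<And>a b. {a..b} \<subseteq> \<Omega> \<Longrightarrow> h absolutely_integrable_on {a..b}"
    and weak: "weak_derivative_on \<Omega> h (\<lambda>x. 0)"
    and ab: "a < b" "{a..b} \<subseteq> \<Omega>" "a' < b'" "{a'..b'} \<subseteq> \<Omega>"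
  shows "(1 / (b - a)) *\<^sub>R integral {a..b} h = (1 / (b' - a')) *\<^sub>R integral {a'..b'} h"
proof -
  obtain N \<phi> C where N: "max b b' \<le> N" "{min a a'..N} \<subseteq> \<Omega>"
    and test: "\<And>n. test_function \<Omega> (\<phi> n)"
    and supp: "\<And>n x. x \<notin> {min a a'..N} \<Longrightarrow> deriv (\<phi> n) x = 0"
    and bd: "\<And>n x. \<bar>deriv (\<phi> n) x\<bar> \<le> C"
    and lim: "\<And>x. (\<lambda>n. deriv (\<phi> n) x) \<longlonglongrightarrow> indicator {a<..b} x / (b - a) - indicator {a'<..b'} x / (b' - a')"
    using plateau_difference_test_functions[OF \<Omega> ab] by metis
  let ?I = "{min a a'..N}"
  let ?g = "\<lambda>x. (indicator {a<..b} x / (b - a) - indicator {a'<..b'} x / (b' - a')) *\<^sub>R h x"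
  have hI: "h absolutely_integrable_on ?I" using h N by blast
  have fi: "(\<lambda>x. deriv (\<phi> n) x *\<^sub>R h x) absolutely_integrable_on ?I" for n
    by (intro absolutely_integrable_continuous_scaleR hI test_function_has_derivative(2)[OF test])
  have f0: "integral ?I (\<lambda>x. deriv (\<phi> n) x *\<^sub>R h x) = 0" for n
  proof -
    have "(LINT x:\<Omega>|lebesgue. deriv (\<phi> n) x *\<^sub>R h x) = 0"
      using weak test by (simp add: weak_derivative_on_def)
    moreover have "(LINT x:\<Omega>|lebesgue. deriv (\<phi> n) x *\<^sub>R h x) = integral ?I (\<lambda>x. deriv (\<phi> n) x *\<^sub>R h x)"
      by (rule set_lebesgue_integral_eq_integral_Icc[OF N(2) fi]) (use supp in simp)
    ultimately show ?thesis by simp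
  qed
  have "(\<lambda>n. integral ?I (\<lambda>x. deriv (\<phi> n) x *\<^sub>R h x)) \<longlonglongrightarrow> integral ?I ?g"
  proof (rule dominated_convergence(2)[where h="\<lambda>x. C * norm (h x)"])
    show "(\<lambda>x. deriv (\<phi> n) x *\<^sub>R h x) integrable_on ?I" for n
      using fi by (rule set_lebesgue_integral_eq_integral)
    show "(\<lambda>x. C * norm (h x)) integrable_on ?I"
      using hI integrable_cmul[of "\<lambda>x. norm (h x)" ?I C] by (simp add: absolutely_integrable_on_def)
    show "norm (deriv (\<phi> n) x *\<^sub>R h x) \<le> C * norm (h x)" for n x
      using bd[of n x] by (simp add: mult_right_mono)
    show "(\<lambda>n. deriv (\<phi> n) x *\<^sub>R h x) \<longlonglongrightarrow> ?g x" for x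
      by (intro tendsto_scaleR lim tendsto_const)
  qed
  then have g0: "integral ?I ?g = 0" using f0 by (simp add: LIMSEQ_const_iff)
  have "((\<lambda>x. (indicator {a<..b} x * (1 / (b - a))) *\<^sub>R h x - (indicator {a'<..b'} x * (1 / (b' - a'))) *\<^sub>R h x)
     has_integral (1 / (b - a)) *\<^sub>R integral {a..b} h - (1 / (b' - a')) *\<^sub>R integral {a'..b'} h) ?I"
    using N by (intro has_integral_diff integral_indicator_Ioc hI) auto
  then have "(?g has_integral (1 / (b - a)) *\<^sub>R integral {a..b} h - (1 / (b' - a')) *\<^sub>R integral {a'..b'} h) ?I"
    by (simp add: scaleR_diff_left)
  from integral_unique[OF this] g0 show ?thesis by simp
qed

text \<open>Lebesgue differentiation: outside a negligible set, \<open>h x\<close> is the limit of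
  the averages over \<open>{x..x + k}\<close>, and these are all 0.\<close>

lemma AE_eq_0_if_integrals_eq_0:
  fixes h :: "real \<Rightarrow> 'b::euclidean_space"
  assumes h: "h absolutely_integrable_on {p..q}"
    and z: "\<And>u v. p \<le> u \<Longrightarrow> u < v \<Longrightarrow> v \<le> q \<Longrightarrow> integral {u..v} h = 0"
  shows "AE x in lebesgue. x \<in> {p<..<q} \<longrightarrow> h x = 0"
proof -
  \<comment> \<open>The differentiation theorem wants integrability on every box, hence the
    extension by 0.\<close>
  define H where "H x = (if x \<in> {p..q} then h x else 0)" for x
  have "H integrable_on cbox u v" for u v
  proof -
    have "h integrable_on {max p u..min q v}"
      using absolutely_integrable_on_Icc_subset[OF h] by (simp add: set_lebesgue_integral_eq_integral(1))
    then show ?thesis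
      unfolding H_def[abs_def] integrable_restrict_Int by (simp add: Int_atLeastAtMost max.commute min.commute)
  qed
  then obtain N where N: "negligible N"
    and lim: "\<And>x e. \<lbrakk>x \<notin> N; 0 < e\<rbrakk> \<Longrightarrow>
       \<exists>d>0. \<forall>k. 0 < k \<and> k < d \<longrightarrow> norm (integral (cbox x (x + k *\<^sub>R One)) H /\<^sub>R k ^ DIM(real) - H x) < e"
    using integrable_ccontinuous_explicit[of H] by blast
  have "h x = 0" if x: "x \<notin> N" "x \<in> {p<..<q}" for x
  proof (rule ccontr)
    assume "h x \<noteq> 0"
    then obtain d where d: "d > 0"
      and *: "\<And>k. 0 < k \<Longrightarrow> k < d \<Longrightarrow> norm (integral {x..x + k} H /\<^sub>R k - H x) < norm (h x)"
      using lim[OF x(1), of "norm (h x)"] by auto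
    define k where "k = min (d/2) (q - x)"
    have k: "0 < k" "k < d" "x + k \<le> q" using d x by (auto simp: k_def min_less_iff_disj)
    have "integral {x..x + k} H = integral {x..x + k} h"
      by (rule integral_cong) (use x k in \<open>auto simp: H_def\<close>)
    also have "\<dots> = 0" using z[of x "x + k"] x k by auto
    finally show False using *[OF k(1,2)] x by (simp add: H_def)
  qed
  then show ?thesis
    using N by (intro AE_I'[of N]) (auto simp: negligible_iff_null_sets)
qed

text \<open>Intervals with rational endpoints already cover \<open>\<Omega>\<close>, and there are
  only countably many exceptional null sets to unite.\<close>

lemma AE_open_if_AE_Ioo:
  assumes "open \<Omega>" and P: "\<And>p q. {p..q} \<subseteq> \<Omega> \<Longrightarrow> AE x in lebesgue. x \<in> {p<..<q} \<longrightarrow> P x"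
  shows "AE x::real in lebesgue. x \<in> \<Omega> \<longrightarrow> P x"
proof -
  define J where "J = {(p, q). p \<in> \<rat> \<and> q \<in> \<rat> \<and> {p..q::real} \<subseteq> \<Omega>}"
  have "J \<subseteq> \<rat> \<times> \<rat>" by (auto simp: J_def)
  then have "countable J" using countable_rat countable_subset by (metis countable_SIGMA)
  then have "AE x in lebesgue. \<forall>j\<in>J. x \<in> {fst j<..<snd j} \<longrightarrow> P x"
    using P by (subst AE_ball_countable) (force simp: J_def)+
  then show ?thesis
  proof eventually_elim
    case (elim x)
    show ?case
    proof
      assume "x \<in> \<Omega>"
      then obtain a b where ab: "a < x" "x < b" "{a..b} \<subseteq> \<Omega>" using open_contains_Icc_around assms(1) by blast
      obtain p q where "p \<in> \<rat>" "a < p" "p < x" "q \<in> \<rat>" "x < q" "q < b"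
        using ab Rats_dense_in_real by metis
      moreover from this ab have "{p..q} \<subseteq> \<Omega>" by force
      ultimately have "(p, q) \<in> J" by (simp add: J_def)
      then show "P x" using elim \<open>p < x\<close> \<open>x < q\<close> by fastforce
    qed
  qed
qed

text \<open>The constant is the average of \<open>h\<close>, which is the same over all intervals;
  after subtracting it every integral vanishes.\<close>

lemma weak_derivative_zero_imp_const:
  fixes h :: "real \<Rightarrow> 'b::euclidean_space"
  assumes \<Omega>: "open \<Omega>" "connected \<Omega>"
    and h: "\<And>a b. {a..b} \<subseteq> \<Omega> \<Longrightarrow> h absolutely_integrable_on {a..b}"
    and weak: "weak_derivative_on \<Omega> h (\<lambda>x. 0)"
  obtains c where "AE x in lebesgue. x \<in> \<Omega> \<longrightarrow> h x = c"
proof (cases "\<Omega> = {}")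
  case True
  then show thesis using that by simp
next
  case False
  then obtain a0 b0 where "a0 < b0" "{a0..b0} \<subseteq> \<Omega>"
    using open_contains_Icc_around[OF \<Omega>(1)] by (metis ex_in_conv less_trans)
  note ab = this
  define c where "c = (1 / (b0 - a0)) *\<^sub>R integral {a0..b0} h"
  have avg: "integral {u..v} (\<lambda>x. h x - c) = 0" if "u < v" "{u..v} \<subseteq> \<Omega>" for u v
  proof -
    have "c = (1 / (v - u)) *\<^sub>R integral {u..v} h"
      unfolding c_def by (rule weak_derivative_zero_averages[OF \<Omega> h weak ab that])
    then have "integral {u..v} h = (v - u) *\<^sub>R c" using that by simp
    moreover have "integral {u..v} (\<lambda>x. h x - c) = integral {u..v} h - integral {u..v} (\<lambda>x. c)"
      using h[OF that(2)] by (intro Henstock_Kurzweil_Integration.integral_diff)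
        (auto intro: set_lebesgue_integral_eq_integral)
    ultimately show ?thesis using that by simp
  qed
  have "AE x in lebesgue. x \<in> \<Omega> \<longrightarrow> h x - c = 0"
  proof (rule AE_open_if_AE_Ioo[OF \<Omega>(1)], rule AE_eq_0_if_integrals_eq_0)
    fix p q assume pq: "{p..q} \<subseteq> \<Omega>"
    show "(\<lambda>x. h x - c) absolutely_integrable_on {p..q}"
      using h[OF pq] by (intro set_integral_diff) auto
    show "integral {u..v} (\<lambda>x. h x - c) = 0" if "p \<le> u" "u < v" "v \<le> q" for u v
      using that pq by (intro avg) auto
  qed
  then show thesis using that by simp
qed

text \<open>Linearity is not purely formal, since the integral is additive only on integrable
  functions; the support of the test function supplies an interval on which both parts are
  integrable.\<close>

lemma weak_derivative_diff_zero:
  fixes f F g :: "real \<Rightarrow> 'b::euclidean_space"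
  assumes \<Omega>: "open \<Omega>" "connected \<Omega>" "\<Omega> \<noteq> {}"
    and f: "\<And>a b. {a..b} \<subseteq> \<Omega> \<Longrightarrow> f absolutely_integrable_on {a..b}"
    and F: "\<And>a b. {a..b} \<subseteq> \<Omega> \<Longrightarrow> F absolutely_integrable_on {a..b}"
    and weak: "weak_derivative_on \<Omega> f g" "weak_derivative_on \<Omega> F g"
  shows "weak_derivative_on \<Omega> (\<lambda>x. f x - F x) (\<lambda>x. 0)"
  unfolding weak_derivative_on_def
proof (intro allI impI)
  fix \<phi> assume t: "test_function \<Omega> \<phi>"
  obtain a b where ab: "a < b" "{a..b} \<subseteq> \<Omega>" "\<And>x. x \<notin> {a<..<b} \<Longrightarrow> deriv \<phi> x = 0"
    using test_function_support[OF t \<Omega>] by metis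
  have eq: "(LINT x:\<Omega>|lebesgue. deriv \<phi> x *\<^sub>R k x) = integral {a..b} (\<lambda>x. deriv \<phi> x *\<^sub>R k x)"
    "(\<lambda>x. deriv \<phi> x *\<^sub>R k x) integrable_on {a..b}"
    if "k absolutely_integrable_on {a..b}" for k :: "real \<Rightarrow> 'b"
  proof -
    have *: "(\<lambda>x. deriv \<phi> x *\<^sub>R k x) absolutely_integrable_on {a..b}"
      using that by (intro absolutely_integrable_continuous_scaleR test_function_has_derivative(2)[OF t])
    show "(LINT x:\<Omega>|lebesgue. deriv \<phi> x *\<^sub>R k x) = integral {a..b} (\<lambda>x. deriv \<phi> x *\<^sub>R k x)"
      by (rule set_lebesgue_integral_eq_integral_Icc[OF ab(2) *]) (use ab(3) in force)
    show "(\<lambda>x. deriv \<phi> x *\<^sub>R k x) integrable_on {a..b}"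
      using * by (rule set_lebesgue_integral_eq_integral)
  qed
  have "integral {a..b} (\<lambda>x. deriv \<phi> x *\<^sub>R (f x - F x))
      = integral {a..b} (\<lambda>x. deriv \<phi> x *\<^sub>R f x) - integral {a..b} (\<lambda>x. deriv \<phi> x *\<^sub>R F x)"
    unfolding scaleR_diff_right
    using f[OF ab(2)] F[OF ab(2)] by (intro Henstock_Kurzweil_Integration.integral_diff eq)
  also have "\<dots> = 0"
    using weak t eq(1)[OF f[OF ab(2)]] eq(1)[OF F[OF ab(2)]] by (simp add: weak_derivative_on_def)
  finally show "(LINT x:\<Omega>|lebesgue. deriv \<phi> x *\<^sub>R (f x - F x)) = - (LINT x:\<Omega>|lebesgue. \<phi> x *\<^sub>R 0)"
    using eq(1)[OF set_integral_diff(1)[OF f[OF ab(2)] F[OF ab(2)]]] by (simp add: set_lebesgue_integral_def)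
qed

text \<open>Any primitive of \<open>g\<close> has the same weak derivative as \<open>f\<close>, so
  the two differ by a constant almost everywhere, which is absorbed into the primitive.\<close>

lemma weak_derivative_imp_primitive:
  fixes f g :: "real \<Rightarrow> 'b::euclidean_space"
  assumes \<Omega>: "open \<Omega>" "connected \<Omega>" "\<Omega> \<noteq> {}"
    and f: "\<And>a b. {a..b} \<subseteq> \<Omega> \<Longrightarrow> f absolutely_integrable_on {a..b}"
    and g: "\<And>a b. {a..b} \<subseteq> \<Omega> \<Longrightarrow> g absolutely_integrable_on {a..b}"
    and weak: "weak_derivative_on \<Omega> f g"
  obtains F where "is_primitive_on \<Omega> F g" "AE x in lebesgue. x \<in> \<Omega> \<longrightarrow> f x = F x"
proof -
  obtain F where F: "is_primitive_on \<Omega> F g" using primitive_exists[OF \<Omega>(2) g] by blast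
  have Fi: "F absolutely_integrable_on {a..b}" if "{a..b} \<subseteq> \<Omega>" for a b
    using is_primitive_on_Icc_continuous[OF is_primitive_on_subset[OF F that]]
    by (rule absolutely_integrable_continuous_real)
  have "weak_derivative_on \<Omega> (\<lambda>x. f x - F x) (\<lambda>x. 0)"
    by (rule weak_derivative_diff_zero[OF \<Omega> f Fi weak weak_derivative_on_primitive[OF F \<Omega>]])
  moreover have "(\<lambda>x. f x - F x) absolutely_integrable_on {a..b}" if "{a..b} \<subseteq> \<Omega>" for a b
    using f[OF that] Fi[OF that] by (rule set_integral_diff)
  ultimately obtain c where c: "AE x in lebesgue. x \<in> \<Omega> \<longrightarrow> f x - F x = c"
    using weak_derivative_zero_imp_const[OF \<Omega>(1,2)] by blast
  show thesis
  proof (rule that)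
    show "is_primitive_on \<Omega> (\<lambda>x. F x + c) g" using F by (simp add: is_primitive_on_def)
    show "AE x in lebesgue. x \<in> \<Omega> \<longrightarrow> f x = F x + c" using c by eventually_elim (auto simp: algebra_simps)
  qed
qed

section \<open>Lifting through the covering by the sphere\<close>

lemma tensor_mult_vec: "(u \<otimes>\<^sub>v v) *v w = (v \<bullet> w) *\<^sub>R u"
  by (simp add: tensor_def matrix_vector_mult_def vec_eq_iff inner_vec_def sum_distrib_right mult_ac sum_distrib_left)

lemma tensor_minus_minus [simp]: "(- u) \<otimes>\<^sub>v (- v) = u \<otimes>\<^sub>v v"
  by (simp add: tensor_def vec_eq_iff)

lemma continuous_on_tensor [continuous_intros]:
  assumes "continuous_on S f" "continuous_on S g"
  shows "continuous_on S (\<lambda>x. f x \<otimes>\<^sub>v g x)"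
  unfolding tensor_def using assms by (intro continuous_intros)

lemma bounded_bilinear_matrix_vector_mult:
  "bounded_bilinear ((*v) :: real^'n^'m \<Rightarrow> real^'n \<Rightarrow> real^'m)"
proof -
  have "bilinear ((*v) :: real^'n^'m \<Rightarrow> real^'n \<Rightarrow> real^'m)"
    unfolding bilinear_def
    by (auto intro!: linearI simp: matrix_vector_mult_add_rdistrib matrix_vector_right_distrib
          scaleR_matrix_vector_assoc matrix_vector_mult_scaleR)
  then show ?thesis by (simp add: bilinear_conv_bounded_bilinear)
qed

lemma continuous_on_matrix_vector_mult [continuous_intros]:
  fixes f :: "'a::topological_space \<Rightarrow> real^'n^'m"
  assumes "continuous_on S f" "continuous_on S g"
  shows "continuous_on S (\<lambda>x. f x *v g x)"
  by (rule bounded_bilinear.continuous_on[OF bounded_bilinear_matrix_vector_mult assms])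

text \<open>If a line is represented by the orthogonal projection onto it, this is the antipodal
  double covering of real projective space.\<close>

lemma covering_space_tensor:
  "covering_space (sphere (0::real^'n) 1) (\<lambda>v. v \<otimes>\<^sub>v v) ((\<lambda>v. v \<otimes>\<^sub>v v) ` sphere (0::real^'n) 1)"
    (is "covering_space ?S ?p ?P")
proof
  show "continuous_on ?S ?p" by (intro continuous_intros)
next
  fix x assume "x \<in> ?P"
  then obtain w where w: "norm w = 1" "x = w \<otimes>\<^sub>v w" by auto
  \<comment> \<open>Over the lines not orthogonal to \<open>w\<close> the two sheets are told apart by the sign of \<open>u \<bullet> w\<close>.\<close>
  define T where "T = {Q \<in> ?P. (Q *v w) \<bullet> w > 0}"
  define U where "U s = {u \<in> ?S. s * (u \<bullet> w) > 0}" for s :: real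
  \<comment> \<open>For \<open>Q = u \<otimes>\<^sub>v u\<close> the vector \<open>Q *v w\<close> is
    the multiple of \<open>u\<close> by \<open>u \<bullet> w\<close>; normalising it picks the
    representative on the side of \<open>w\<close>, and \<open>s\<close> selects the sheet.\<close>
  define q where "q s Q = (s / norm (Q *v w)) *\<^sub>R (Q *v w)" for s :: real and Q :: "real^'n^'n"
  have "open {Q :: real^'n^'n. (Q *v w) \<bullet> w > 0}"
    by (intro open_Collect_less continuous_intros)
  then have "openin (top_of_set ?P) (?P \<inter> {Q. (Q *v w) \<bullet> w > 0})" by (rule openin_open_Int)
  then have oT: "openin (top_of_set ?P) T" by (simp add: T_def Int_def)
  have oU: "openin (top_of_set ?S) (U s)" for s
  proof -
    have "open {u. s * (u \<bullet> w) > 0}" by (intro open_Collect_less continuous_intros)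
    then have "openin (top_of_set ?S) (?S \<inter> {u. s * (u \<bullet> w) > 0})" by (rule openin_open_Int)
    then show ?thesis by (simp add: U_def Int_def)
  qed
  have pT: "?p u \<in> T \<longleftrightarrow> u \<bullet> w \<noteq> 0" if "u \<in> ?S" for u
    using that by (auto simp: T_def tensor_mult_vec zero_less_mult_iff)
  have hom: "homeomorphism (U s) T ?p (q s)" if s: "s = 1 \<or> s = -1" for s
  proof -
    have qp: "q s (?p u) = u" if "u \<in> U s" for u
    proof -
      have "norm ((w \<bullet> u) *\<^sub>R u) = s * (w \<bullet> u)" using that s by (auto simp: U_def inner_commute)
      moreover have "w \<bullet> u \<noteq> 0" using that by (auto simp: U_def inner_commute)
      moreover have "s * s = 1" using s by auto
      ultimately show ?thesis
        unfolding q_def by (simp add: tensor_mult_vec inner_commute) (use s in auto)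
    qed
    have ex: "\<exists>u\<in>U s. Q = ?p u" if "Q \<in> T" for Q
    proof -
      obtain v where v: "v \<in> ?S" "Q = ?p v" using \<open>Q \<in> T\<close> by (auto simp: T_def)
      then have "v \<bullet> w \<noteq> 0" using pT \<open>Q \<in> T\<close> by auto
      then have "v \<in> U s \<or> - v \<in> U s" using v s by (auto simp: U_def)
      then show ?thesis using v by (metis tensor_minus_minus)
    qed
    show ?thesis
    proof (rule homeomorphismI)
      show "continuous_on (U s) ?p" by (intro continuous_intros)
      show "continuous_on T (q s)" unfolding q_def
        by (intro continuous_intros) (auto simp: T_def)
      show "?p ` U s \<subseteq> T" using pT by (auto simp: U_def)
      show "q s ` T \<subseteq> U s" using ex qp by force
      show "q s (?p u) = u" if "u \<in> U s" for u using qp that .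
      show "?p (q s Q) = Q" if "Q \<in> T" for Q using ex[OF that] qp by force
    qed
  qed
  show "\<exists>T. x \<in> T \<and> openin (top_of_set ?P) T \<and>
      (\<exists>V. \<Union>V = ?S \<inter> ?p -` T \<and> (\<forall>u\<in>V. openin (top_of_set ?S) u) \<and> pairwise disjnt V \<and>
        (\<forall>u\<in>V. \<exists>q. homeomorphism u T ?p q))"
  proof (intro exI[of _ T] exI[of _ "{U 1, U (-1)}"] conjI)
    show "x \<in> T" using pT[of w] w by auto
    show "\<Union>{U 1, U (-1)} = ?S \<inter> ?p -` T" using pT by (auto simp: U_def)
    show "pairwise disjnt {U 1, U (-1)}" by (auto simp: pairwise_insert disjnt_def U_def)
  qed (use oT oU hom in auto)
qed simp

text \<open>A connected subset of the line is convex, hence simply connected, so no monodromy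
  obstructs a global choice of sign.\<close>

lemma continuous_lift_tensor:
  fixes Q :: "real \<Rightarrow> real^'n^'n"
  assumes "open \<Omega>" "connected \<Omega>" "continuous_on \<Omega> Q"
    and "\<And>x. x \<in> \<Omega> \<Longrightarrow> Q x \<in> (\<lambda>v. v \<otimes>\<^sub>v v) ` sphere 0 1"
  obtains m where "continuous_on \<Omega> m" "\<And>x. x \<in> \<Omega> \<Longrightarrow> norm (m x) = 1"
    "\<And>x. x \<in> \<Omega> \<Longrightarrow> m x \<otimes>\<^sub>v m x = Q x"
proof -
  have "simply_connected \<Omega>"
    by (meson assms(2) convex_imp_simply_connected is_interval_connected_1 is_interval_convex_1)
  moreover have "Q \<in> \<Omega> \<rightarrow> (\<lambda>v. v \<otimes>\<^sub>v v) ` sphere 0 1" using assms(4) by blast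
  ultimately obtain m where "continuous_on \<Omega> m" "m \<in> \<Omega> \<rightarrow> sphere 0 1" "\<And>x. x \<in> \<Omega> \<Longrightarrow> m x \<otimes>\<^sub>v m x = Q x"
    using covering_space_lift[OF covering_space_tensor _ open_imp_locally_path_connected[OF assms(1)] assms(3)]
    by blast
  then show thesis by (intro that) (auto simp: Pi_iff)
qed

text \<open>Both projections scale by the same factor: they send \<open>a + b\<close> to
  \<open>1 + a \<bullet> b\<close> times \<open>b\<close> and \<open>a\<close> respectively.
  Dividing by this factor gives an exact finite-difference form of \<open>m' = G m\<close>, with the
  secant vector \<open>(a + b) / (1 + a \<bullet> b)\<close> in place of \<open>m\<close>.\<close>

lemma unit_secant_identity:
  fixes a b :: "real^'n"
  assumes "norm a = 1" "norm b = 1"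
  shows "(b \<otimes>\<^sub>v b - a \<otimes>\<^sub>v a) *v (a + b) = (1 + a \<bullet> b) *\<^sub>R (b - a)"
proof -
  have "a \<bullet> a = 1" "b \<bullet> b = 1" using assms by (simp_all add: dot_square_norm)
  then show ?thesis
    by (simp add: matrix_vector_mult_diff_rdistrib tensor_mult_vec inner_add_right inner_commute algebra_simps)
qed

text \<open>The factor \<open>1 + a \<bullet> b\<close> is \<open>2 - s\<close> with
  \<open>s\<close> quadratic in the distance of \<open>a\<close> and \<open>b\<close>. So the secant
  vector is within \<delta> of the midpoint of \<open>a\<close> and \<open>b\<close>, which in turn
  is within \<delta> of \<open>c\<close>.\<close>

lemma unit_secant_midpoint:
  fixes a b c :: "'a::real_inner"
  assumes "norm a = 1" "norm b = 1" "norm (b - a) \<le> \<delta>" "\<delta> \<le> 1" "norm (a - c) \<le> \<delta>" "norm (b - c) \<le> \<delta>"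
  shows "1 + a \<bullet> b > 0" "norm ((1 / (1 + a \<bullet> b)) *\<^sub>R (a + b) - c) \<le> 2 * \<delta>"
proof -
  define s where "s = (norm (b - a))\<^sup>2 / 2"
  have "a \<bullet> a = 1" "b \<bullet> b = 1" using assms by (simp_all add: dot_square_norm)
  then have ab: "a \<bullet> b = 1 - s"
    by (simp add: s_def power2_norm_eq_inner inner_diff_left inner_diff_right inner_commute field_simps)
  have "\<delta> \<ge> 0" using assms(3) norm_ge_zero order_trans by blast
  have "(norm (b - a))\<^sup>2 \<le> \<delta>\<^sup>2" using assms(3) by (intro power_mono) auto
  also have "\<delta>\<^sup>2 \<le> \<delta>" using \<open>\<delta> \<ge> 0\<close> assms(4) by (simp add: power2_eq_square mult_left_le)
  finally have s: "0 \<le> s" "s \<le> \<delta> / 2" by (auto simp: s_def)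
  then have s1: "s \<le> 1/2" using assms(4) by simp
  then show pos: "1 + a \<bullet> b > 0" using ab by simp
  define m where "m = (1/2) *\<^sub>R (a + b)"
  have "norm (a + b) \<le> 2" using norm_triangle_ineq[of a b] assms by simp
  then have m: "norm m \<le> 1" by (simp add: m_def)
  have "m - c = (1/2) *\<^sub>R ((a - c) + (b - c))" by (simp add: m_def algebra_simps flip: scaleR_add_left)
  then have mc: "norm (m - c) \<le> \<delta>" using norm_triangle_ineq[of "a - c" "b - c"] assms(5,6) by simp
  have "(1 / (1 + a \<bullet> b)) *\<^sub>R (a + b) - m = (s / (2 - s)) *\<^sub>R m"
  proof -
    have "1 / (2 - s) - 1/2 = (s / (2 - s)) / 2" using s1 by (simp add: field_simps)
    then show ?thesis by (simp add: ab m_def flip: scaleR_diff_left)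
  qed
  moreover have "s / (2 - s) \<le> \<delta>"
  proof -
    have "s / (2 - s) \<le> s / 1" using s s1 by (intro divide_left_mono) auto
    then show ?thesis using s \<open>\<delta> \<ge> 0\<close> by simp
  qed
  moreover have "norm ((s / (2 - s)) *\<^sub>R m) \<le> s / (2 - s)"
    using m s s1 by (simp add: mult_left_le divide_right_mono)
  ultimately have "norm ((1 / (1 + a \<bullet> b)) *\<^sub>R (a + b) - m) \<le> \<delta>" by simp
  then show "norm ((1 / (1 + a \<bullet> b)) *\<^sub>R (a + b) - c) \<le> 2 * \<delta>"
    using mc norm_triangle_ineq[of "(1 / (1 + a \<bullet> b)) *\<^sub>R (a + b) - m" "m - c"] by simp
qed

lemma absolutely_integrable_matrix_vector_mult:
  fixes G :: "real \<Rightarrow> real^'n^'m"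
  assumes "G absolutely_integrable_on {a..b}" "continuous_on {a..b} m"
  shows "(\<lambda>t. G t *v m t) absolutely_integrable_on {a..b}"
proof -
  have "bilinear (\<lambda>v A. A *v v :: real^'m)" for v :: "real^'n"
    using bounded_bilinear.flip[OF bounded_bilinear_matrix_vector_mult] bilinear_conv_bounded_bilinear by blast
  moreover have "bounded (m ` {a..b})"
    by (intro compact_imp_bounded compact_continuous_image assms(2)) auto
  moreover have "m \<in> borel_measurable (lebesgue_on {a..b})"
    by (intro continuous_imp_measurable_on_sets_lebesgue assms(2)) auto
  ultimately show ?thesis
    using absolutely_integrable_bounded_measurable_product[where h="\<lambda>v A. A *v v", OF _ _ _ _ assms(1)] by simp
qed

text \<open>On a short interval the increment of \<open>m\<close> is exactly the integral of
  \<open>G t *v w\<close> for the constant secant vector \<open>w\<close>. Replacing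
  \<open>w\<close> by \<open>m t\<close> costs a small multiple of \<open>norm (G t)\<close>, so the
  integral of \<open>norm (G t)\<close> is the control function.\<close>

lemma lift_is_primitive:
  fixes Q G :: "real \<Rightarrow> real^'n^'n"
  assumes Q: "is_primitive_on \<Omega> Q G" and m: "continuous_on \<Omega> m"
    and unit: "\<And>x. x \<in> \<Omega> \<Longrightarrow> norm (m x) = 1" and lift: "\<And>x. x \<in> \<Omega> \<Longrightarrow> m x \<otimes>\<^sub>v m x = Q x"
  shows "is_primitive_on \<Omega> m (\<lambda>x. G x *v m x)"
  unfolding is_primitive_on_def
proof (intro allI impI conjI)
  fix a b :: real assume ab: "a \<le> b" "{a..b} \<subseteq> \<Omega>"
  interpret mv: bounded_bilinear "(*v) :: real^'n^'n \<Rightarrow> real^'n \<Rightarrow> real^'n"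
    by (rule bounded_bilinear_matrix_vector_mult)
  obtain K where K: "K > 0" "\<And>A x. norm ((A :: real^'n^'n) *v x) \<le> norm A * norm x * K"
    using mv.pos_bounded by blast
  have cm: "continuous_on {a..b} m" using m ab continuous_on_subset by blast
  have iG: "G absolutely_integrable_on {a..b}" using is_primitive_onD(1)[OF Q ab] .
  define h where "h t = G t *v m t" for t
  have ih: "h absolutely_integrable_on {a..b}"
    unfolding h_def[abs_def] by (rule absolutely_integrable_matrix_vector_mult[OF iG cm])
  then show "(\<lambda>x. G x *v m x) absolutely_integrable_on {a..b}" by (simp add: h_def[abs_def])
  have ik: "(\<lambda>t. norm (G t)) absolutely_integrable_on {a..b}"
    using absolutely_integrable_norm[OF iG] by (simp add: o_def)
  define R where "R x = m x - integral {a..x} h" for x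
  have "R b = R a"
  proof (rule eq_if_increments_small[where V="\<lambda>x. integral {a..x} (\<lambda>t. norm (G t))", OF ab(1)])
    fix e :: real assume e: "e > 0"
    \<comment> \<open>The bound 1 is demanded by \<open>unit_secant_midpoint\<close>;
      \<open>e / (2 * K)\<close> turns its error \<open>2 * \<delta>\<close>, multiplied by the
      bilinear constant \<open>K\<close>, into at most \<open>e\<close>.\<close>
    define \<delta> where "\<delta> = min 1 (e / (2 * K))"
    have \<delta>: "\<delta> > 0" "\<delta> \<le> 1" "2 * \<delta> * K \<le> e" using e K(1) by (auto simp: \<delta>_def min_def field_simps)
    have "uniformly_continuous_on {a..b} m" using cm by (auto intro: compact_uniformly_continuous)
    then obtain d where d: "d > 0" "\<And>x y. x \<in> {a..b} \<Longrightarrow> y \<in> {a..b} \<Longrightarrow> dist y x < d \<Longrightarrow> dist (m y) (m x) < \<delta>"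
      unfolding uniformly_continuous_on_def using \<delta> by metis
    have "norm (R v - R u) \<le> e * (integral {a..v} (\<lambda>t. norm (G t)) - integral {a..u} (\<lambda>t. norm (G t)))"
      if uv: "a \<le> u" "u \<le> v" "v \<le> b" "v - u < d" for u v
    proof -
      define w where "w = (1 / (1 + m u \<bullet> m v)) *\<^sub>R (m u + m v)"
      have u: "norm (m u) = 1" "norm (m v) = 1" and Quv: "m u \<otimes>\<^sub>v m u = Q u" "m v \<otimes>\<^sub>v m v = Q v"
        using uv ab unit[of u] unit[of v] lift[of u] lift[of v] by (simp_all add: subset_iff)
      have close: "norm (m y - m x) \<le> \<delta>" if "x \<in> {u..v}" "y \<in> {u..v}" for x y
      proof -
        have "x \<in> {a..b}" "y \<in> {a..b}" "dist y x < d" using that uv by (auto simp: dist_real_def)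
        from d(2)[OF this] show ?thesis by (simp add: dist_norm)
      qed
      have wt: "1 + m u \<bullet> m v > 0" "norm (w - m t) \<le> 2 * \<delta>" if "t \<in> {u..v}" for t
        unfolding w_def using unit_secant_midpoint[OF u close[of u v] \<delta>(2) close[of t u] close[of t v]] that uv by auto
      have hi: "h integrable_on {u..v}" and ki: "(\<lambda>t. norm (G t)) integrable_on {u..v}" and gi: "G integrable_on {u..v}"
        using uv absolutely_integrable_on_Icc_subset[OF ih, of u v] absolutely_integrable_on_Icc_subset[OF ik, of u v]
          absolutely_integrable_on_Icc_subset[OF iG, of u v] by (simp_all add: set_lebesgue_integral_eq_integral(1))
      have "{u..v} \<subseteq> \<Omega>" using uv ab by auto
      then have "(G has_integral Q v - Q u) {u..v}"
        using is_primitive_onD(2)[OF Q, of u v] uv integrable_integral[OF gi] by auto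
      from has_integral_linear[OF this mv.bounded_linear_left[of w]]
      have "((\<lambda>t. G t *v w) has_integral (Q v - Q u) *v w) {u..v}" by (simp add: o_def)
      moreover have "(Q v - Q u) *v w = m v - m u"
        using unit_secant_identity[OF u] wt(1)[of u] uv by (simp add: w_def Quv mv.scaleR_right)
      ultimately have "((\<lambda>t. G t *v w - h t) has_integral (m v - m u - integral {u..v} h)) {u..v}"
        by (intro has_integral_diff integrable_integral hi) auto
      moreover have "m v - m u - integral {u..v} h = R v - R u"
        using integral_diff_Icc[OF ih uv(1-3)] by (simp add: R_def algebra_simps)
      ultimately have I: "((\<lambda>t. G t *v w - h t) has_integral (R v - R u)) {u..v}" by simp
      have "norm (integral {u..v} (\<lambda>t. G t *v w - h t)) \<le> integral {u..v} (\<lambda>t. e * norm (G t))"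
      proof (rule Henstock_Kurzweil_Integration.integral_norm_bound_integral)
        show "(\<lambda>t. G t *v w - h t) integrable_on {u..v}" using I by blast
        show "(\<lambda>t. e * norm (G t)) integrable_on {u..v}" using integrable_cmul[OF ki, of e] by simp
        fix t assume t: "t \<in> {u..v}"
        have "norm (G t *v w - h t) \<le> norm (G t) * norm (w - m t) * K"
          using K(2)[of "G t" "w - m t"] by (simp add: h_def mv.diff_right)
        also have "\<dots> \<le> norm (G t) * (2 * \<delta>) * K"
          using wt(2)[OF t] K(1) by (intro mult_right_mono mult_left_mono) auto
        also have "\<dots> = (2 * \<delta> * K) * norm (G t)" by simp
        also have "\<dots> \<le> e * norm (G t)" using \<delta>(3) by (intro mult_right_mono) auto
        finally show "norm (G t *v w - h t) \<le> e * norm (G t)" .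
      qed
      also have "\<dots> = e * (integral {a..v} (\<lambda>t. norm (G t)) - integral {a..u} (\<lambda>t. norm (G t)))"
        using integral_diff_Icc[OF ik uv(1-3)] by simp
      finally show ?thesis using integral_unique[OF I] by simp
    qed
    then show "\<exists>d>0. \<forall>u v. a \<le> u \<and> u \<le> v \<and> v \<le> b \<and> v - u < d \<longrightarrow>
        norm (R v - R u) \<le> e * (integral {a..v} (\<lambda>t. norm (G t)) - integral {a..u} (\<lambda>t. norm (G t)))"
      using d by (intro exI[of _ d]) auto
  qed
  then show "m b - m a = integral {a..b} (\<lambda>x. G x *v m x)" by (simp add: R_def h_def[abs_def] algebra_simps)
qed

section \<open>Local Lebesgue spaces\<close>

text \<open>For p \<ge> 1 every t \<ge> 0 satisfies t \<le> 1 + t^p, and constants are integrable on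
  a bounded interval.\<close>

lemma Lp_loc_absolutely_integrable:
  fixes f :: "real \<Rightarrow> 'b::euclidean_space"
  assumes f: "f \<in> Lp_loc p \<Omega>" and "1 \<le> p" "{a..b} \<subseteq> \<Omega>"
  shows "f absolutely_integrable_on {a..b}"
proof (rule measurable_bounded_by_integrable_imp_absolutely_integrable)
  show "f \<in> borel_measurable (lebesgue_on {a..b})"
    using f assms(3) by (auto simp: Lp_loc_def intro: measurable_restrict_mono)
  have "(\<lambda>x. norm (f x) powr p) absolutely_integrable_on {a..b}"
    using f assms(3) by (simp add: Lp_loc_def)
  then show "(\<lambda>x. 1 + norm (f x) powr p) integrable_on {a..b}"
    by (intro Henstock_Kurzweil_Integration.integrable_add set_lebesgue_integral_eq_integral) auto
  show "norm (f x) \<le> 1 + norm (f x) powr p" for x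
  proof (cases "norm (f x) \<le> 1")
    case False
    then show ?thesis using powr_mono[OF assms(2), of "norm (f x)"] by simp
  qed (simp add: add_increasing2)
qed auto

lemma Lp_loc_continuous:
  fixes f :: "real \<Rightarrow> 'b::euclidean_space"
  assumes "open \<Omega>" "continuous_on \<Omega> f" "0 \<le> p"
  shows "f \<in> Lp_loc p \<Omega>"
  unfolding Lp_loc_def
proof (intro CollectI conjI allI impI)
  show f: "f \<in> borel_measurable (lebesgue_on \<Omega>)"
    using assms by (intro continuous_imp_measurable_on_sets_lebesgue) auto
  fix K assume K: "compact K \<and> K \<subseteq> \<Omega>"
  have "compact (f ` K)" using K assms(2) by (meson compact_continuous_image continuous_on_subset)
  then obtain B where B: "\<And>x. x \<in> K \<Longrightarrow> norm (f x) \<le> B"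
    by (metis bounded_iff compact_imp_bounded image_eqI)
  show "set_integrable lebesgue K (\<lambda>x. norm (f x) powr p)"
  proof (rule measurable_bounded_by_integrable_imp_absolutely_integrable)
    have "f \<in> borel_measurable (lebesgue_on K)" using f K by (auto intro: measurable_restrict_mono)
    then show "(\<lambda>x. norm (f x) powr p) \<in> borel_measurable (lebesgue_on K)" by measurable
    show "(\<lambda>x. B powr p) integrable_on K" using K by (intro integrable_on_const lmeasurable_compact) simp
    show "norm (norm (f x) powr p) \<le> B powr p" if "x \<in> K" for x
      using powr_mono2[OF assms(3) norm_ge_zero B[OF that]] by simp
  qed (use K in \<open>simp add: fmeasurableD lmeasurable_compact\<close>)
qed

lemma Lp_loc_dominated:
  fixes f :: "real \<Rightarrow> 'b::euclidean_space" and g :: "real \<Rightarrow> 'c::euclidean_space"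
  assumes g: "g \<in> Lp_loc p \<Omega>" and "0 \<le> p" and f: "f \<in> borel_measurable (lebesgue_on \<Omega>)"
    and le: "\<And>x. x \<in> \<Omega> \<Longrightarrow> norm (f x) \<le> C * norm (g x)" and "C \<ge> 0"
  shows "f \<in> Lp_loc p \<Omega>"
  unfolding Lp_loc_def
proof (intro CollectI conjI allI impI)
  fix K assume K: "compact K \<and> K \<subseteq> \<Omega>"
  show "set_integrable lebesgue K (\<lambda>x. norm (f x) powr p)"
  proof (rule measurable_bounded_by_integrable_imp_absolutely_integrable)
    have "f \<in> borel_measurable (lebesgue_on K)" using f K by (auto intro: measurable_restrict_mono)
    then show "(\<lambda>x. norm (f x) powr p) \<in> borel_measurable (lebesgue_on K)" by measurable
    have "(\<lambda>x. norm (g x) powr p) absolutely_integrable_on K" using g K by (simp add: Lp_loc_def)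
    then show "(\<lambda>x. C powr p * norm (g x) powr p) integrable_on K"
      using integrable_cmul[of "\<lambda>x. norm (g x) powr p" K "C powr p"] by (simp add: set_lebesgue_integral_eq_integral)
    show "norm (norm (f x) powr p) \<le> C powr p * norm (g x) powr p" if "x \<in> K" for x
      using powr_mono2[OF assms(2) norm_ge_zero le[of x]] that K \<open>C \<ge> 0\<close> by (auto simp: powr_mult)
  qed (use K in \<open>simp add: fmeasurableD lmeasurable_compact\<close>)
qed (fact f)

text \<open>By continuity the points where \<open>F\<close> leaves \<open>P\<close> form an open
  set; it is negligible, and a nonempty open set is not.\<close>

lemma AE_imp_everywhere_closed:
  fixes F :: "real \<Rightarrow> 'b::topological_space"
  assumes "open \<Omega>" "continuous_on \<Omega> F" "closed P" and ae: "AE x in lebesgue. x \<in> \<Omega> \<longrightarrow> F x \<in> P" and "x \<in> \<Omega>"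
  shows "F x \<in> P"
proof (rule ccontr)
  assume "F x \<notin> P"
  define S where "S = \<Omega> \<inter> F -` (- P)"
  have "open S" unfolding S_def using assms by (intro continuous_open_preimage) auto
  moreover have "S \<noteq> {}" using \<open>F x \<notin> P\<close> \<open>x \<in> \<Omega>\<close> by (auto simp: S_def)
  ultimately have "\<not> negligible S" by (rule open_not_negligible)
  moreover have "negligible S"
  proof -
    have "AE y in lebesgue. y \<notin> S" using ae by eventually_elim (auto simp: S_def)
    then show ?thesis
      using \<open>open S\<close> by (simp add: negligible_iff_null_sets AE_iff_null_sets)
  qed
  ultimately show False by simp
qed

theorem proposition4p1:
  fixes \<Omega> :: "real set" and p :: real and n :: "real \<Rightarrow> real^3"
  assumes "open \<Omega>" "connected \<Omega>" "\<Omega> \<noteq> {}" "bounded \<Omega>"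
    and "1 \<le> p"
    and "\<forall>x\<in>\<Omega>. norm (n x) = 1"
    and "(\<lambda>x. n x \<otimes>\<^sub>v n x) \<in> W1p_loc p \<Omega>"
  shows "\<exists>m :: real \<Rightarrow> real^3.
    m \<in> W1p_loc p \<Omega> \<and> continuous_on \<Omega> m \<and> (\<forall>x\<in>\<Omega>. m x \<in> sphere 0 1) \<and>
    (\<forall>x\<in>\<Omega>. m x \<otimes>\<^sub>v m x = precise_rep (\<lambda>y. n y \<otimes>\<^sub>v n y) x)"
proof -
  let ?N = "\<lambda>x. n x \<otimes>\<^sub>v n x" and ?P = "(\<lambda>v. v \<otimes>\<^sub>v v) ` sphere (0::real^3) 1"
  obtain G where N: "?N \<in> Lp_loc p \<Omega>" and G: "G \<in> Lp_loc p \<Omega>" and weak: "weak_derivative_on \<Omega> ?N G"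
    using assms(7) by (auto simp: W1p_loc_def)
  obtain Q where Q: "is_primitive_on \<Omega> Q G" and ae: "AE x in lebesgue. x \<in> \<Omega> \<longrightarrow> ?N x = Q x"
    by (rule weak_derivative_imp_primitive[OF assms(1-3) Lp_loc_absolutely_integrable[OF N assms(5)]
          Lp_loc_absolutely_integrable[OF G assms(5)] weak])
  have cQ: "continuous_on \<Omega> Q" using is_primitive_on_continuous[OF Q assms(1)] .
  have "continuous_on (sphere (0::real^3) 1) (\<lambda>v. v \<otimes>\<^sub>v v)" by (intro continuous_intros)
  then have "closed ?P" by (rule compact_imp_closed[OF compact_continuous_image]) (rule compact_sphere)
  moreover have "AE x in lebesgue. x \<in> \<Omega> \<longrightarrow> Q x \<in> ?P"
    using ae
  proof eventually_elim
    case (elim x)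
    show ?case
    proof
      assume x: "x \<in> \<Omega>"
      then have "n x \<in> sphere 0 1" using assms(6) by simp
      then show "Q x \<in> ?P" using elim x by (intro image_eqI[of _ _ "n x"]) simp_all
    qed
  qed
  ultimately have QP: "Q x \<in> ?P" if "x \<in> \<Omega>" for x
    using that by (rule AE_imp_everywhere_closed[OF assms(1) cQ])
  show ?thesis
  proof (rule continuous_lift_tensor[OF assms(1,2) cQ QP])
    fix m :: "real \<Rightarrow> real^3"
    assume m: "continuous_on \<Omega> m" and unit: "\<And>x. x \<in> \<Omega> \<Longrightarrow> norm (m x) = 1"
      and lift: "\<And>x. x \<in> \<Omega> \<Longrightarrow> m x \<otimes>\<^sub>v m x = Q x"
    let ?g = "\<lambda>x. G x *v m x"
    obtain K where K: "K > 0" "\<And>A x. norm ((A :: real^3^3) *v x) \<le> norm A * norm x * K"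
      using bounded_bilinear.pos_bounded[OF bounded_bilinear_matrix_vector_mult] by blast
    have \<Omega>m: "\<Omega> \<in> sets lebesgue" using assms(1) by auto
    have "?g \<in> Lp_loc p \<Omega>"
    proof (rule Lp_loc_dominated[OF G])
      have mm: "m \<in> borel_measurable (lebesgue_on \<Omega>)" by (rule continuous_imp_measurable_on_sets_lebesgue[OF m \<Omega>m])
      have Gm: "G \<in> borel_measurable (lebesgue_on \<Omega>)" using G by (simp add: Lp_loc_def)
      show "?g \<in> borel_measurable (lebesgue_on \<Omega>)"
        by (rule borel_measurable_bilinear[OF bounded_bilinear_matrix_vector_mult[folded bilinear_conv_bounded_bilinear] Gm mm \<Omega>m])
      show "norm (?g x) \<le> K * norm (G x)" if "x \<in> \<Omega>" for x
        using K(2)[of "G x" "m x"] unit[OF that] by (simp add: mult.commute)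
    qed (use assms(5) K(1) in auto)
    moreover have "weak_derivative_on \<Omega> m ?g"
      by (rule weak_derivative_on_primitive[OF lift_is_primitive[OF Q m unit lift] assms(1-3)])
    moreover have "m \<in> Lp_loc p \<Omega>" by (rule Lp_loc_continuous[OF assms(1) m]) (use assms(5) in simp)
    ultimately have "m \<in> W1p_loc p \<Omega>" by (auto simp: W1p_loc_def)
    \<comment> \<open>The field \<open>n x \<otimes>\<^sub>v n x\<close> may differ from
      \<open>Q\<close> on a null set, but its averages are those of the continuous \<open>Q\<close>,
      so its precise representative is \<open>Q\<close> at every point.\<close>
    moreover have "m x \<otimes>\<^sub>v m x = precise_rep ?N x" if "x \<in> \<Omega>" for x
    proof -
      have "?N \<in> borel_measurable (lebesgue_on \<Omega>)" using N by (simp add: Lp_loc_def)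
      from precise_rep_eq_continuous[OF assms(1) that cQ this ae] lift[OF that] show ?thesis by simp
    qed
    ultimately show ?thesis using m unit by auto
  qed
qed

end
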